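(* Let $n=2$, $D=B\left(0,\frac14\right)\subset\mathbb{R}^2$, and let $\eta:\left[0,\frac13\right)\to\left[0,\frac13\right)$ satisfy $\lim_{\varepsilon\to0}\eta(\varepsilon)=0$. For $\varepsilon\in\left(0,\frac13\right)$ put $$\Omega^{\eta(\varepsilon)}=\mathbb{R}^2\setminus\bigcup_{m\in\mathbb{Z}^2}\left(m+\eta(\varepsilon)\overline D\right),\qquad\Omega_\varepsilon=\varepsilon\,\Omega^{\eta(\varepsilon)} .$$ Let $H(y,p)=\frac{a(y)|p|^2}{2}$ for $(y,p)\in\mathbb{R}^2\times\mathbb{R}^2$, where $a$ is the Lipschitz function depending only on $y_2$, $1$-periodic in $y_2$, with $a(y)=1-|y_2|$ for $y_2\in\left[-\frac12,\frac12\right]$. Let $g(x)=-x_1$ for $x=(x_1,x_2)\in\mathbb{R}^2$. For $\varepsilon\in\left(0,\frac13\right)$ let $u^\varepsilon:\overline\Omega_\varepsilon\times[0,\infty)\to\mathbb{R}$ be the unique viscosity solution of the state-constraint problem $$u^\varepsilon_t+H\left(\tfrac{x}{\varepsilon},Du^\varepsilon\right)\le 0\ \text{ in }\Omega_\varepsilon\times(0,\infty),\quad u^\varepsilon_t+H\left(\tfrac{x}{\varepsilon},Du^\varepsilon\right)\ge 0\ \text{ on }\overline{\Omega}_\varepsilon\times(0,\infty),\quad u^\varepsilon(\cdot,0)=g\ \text{ on }\overline{\Omega}_\varepsilon,$$ and let $\tilde u^\varepsilon:\mathbb{R}^2\times[0,\infty)\to\mathbb{R}$ be the unique viscosity solution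 of $\tilde u^\varepsilon_t+H\left(\frac x\varepsilon,D\tilde u^\varepsilon\right)=0$ in $\mathbb{R}^2\times(0,\infty)$, $\tilde u^\varepsilon(\cdot,0)=g$ on $\mathbb{R}^2$. Let $\{e_1,e_2\}$ be the canonical basis of $\mathbb{R}^2$. Then there exists a constant $C>0$ independent of $\varepsilon\in\left(0,\frac13\right)$ such that $$u^\varepsilon\left(\frac{\varepsilon\eta(\varepsilon)}{4}e_2,1\right)\ge\tilde u^\varepsilon\left(\frac{\varepsilon\eta(\varepsilon)}{4}e_2,1\right)-C\varepsilon\eta(\varepsilon)-C\varepsilon+C\,\eta(\varepsilon)^2 .$$
   Context: State-constraint viscosity solutions: $u^\varepsilon$, continuous on $\overline{\Omega}_\varepsilon\times[0,\infty)$, is a viscosity subsolution in $\Omega_\varepsilon\times(0,\infty)$ in the usual sense and a supersolution on $\overline{\Omega}_\varepsilon\times(0,\infty)$: whenever $\varphi$ is $C^1$ and $u^\varepsilon-\varphi$ has a local minimum relative to $\overline{\Omega}_\varepsilon\times(0,\infty)$ at $(x_0,t_0)$, one has $\varphi_t(x_0,t_0)+H(x_0/\varepsilon,D\varphi(x_0,t_0))\ge0$. Equivalently, with $L(y,v)=\sup_p(p\cdot v-H(y,p))$, $$u^\varepsilon(x,t)=\inf\left\{\int_0^tL\left(\tfrac{\xi(s)}{\varepsilon},\dot\xi(s)\right)ds+g(\xi(0)):\ \xi\in\mathrm{AC}([0,t];\overline\Omega_\varepsilon),\ \xi(t)=x\right\},$$ and $\tilde u^\varepsilon$ is given by the same formula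 with $\mathbb{R}^2$ in place of $\overline\Omega_\varepsilon$; here $\mathrm{AC}(J;U)$ is the set of absolutely continuous curves $J\to U$. *)

theory Defs
  imports "HOL-Analysis.Analysis"
begin

text \<open>A function of space and time is a function on \<open>'a \<times> real\<close>. Test functions are \<open>C\<^sup>1\<close> on
  \<open>UNIV \<times> {0<..}\<close>; \<open>D\<phi>\<close> is the spatial gradient and \<open>\<phi>t\<close> the time derivative of \<open>\<phi>\<close>.\<close>

definition C1_test ::
  "('a::euclidean_space \<times> real \<Rightarrow> real) \<Rightarrow> ('a \<times> real \<Rightarrow> 'a) \<Rightarrow> ('a \<times> real \<Rightarrow> real) \<Rightarrow> bool" where
  "C1_test \<phi> D\<phi> \<phi>t \<longleftrightarrow>
     (\<forall>z \<in> UNIV \<times> {0<..}. (\<phi> has_derivative (\<lambda>(h, k). D\<phi> z \<bullet> h + \<phi>t z * k)) (at z)) \<and>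
     continuous_on (UNIV \<times> {0<..}) D\<phi> \<and> continuous_on (UNIV \<times> {0<..}) \<phi>t"

text \<open>Sub- and supersolutions of \<open>u\<^sub>t + H (x, D u) = 0\<close> on \<open>S \<times> {0<..}\<close>. Extrema are relative to
  \<open>S \<times> {0<..}\<close>; for \<open>S\<close> open these are the usual notions, for \<open>S\<close> closed the supersolution
  condition at boundary points is the state constraint.\<close>

definition viscosity_subsolution ::
  "('a::euclidean_space \<Rightarrow> 'a \<Rightarrow> real) \<Rightarrow> 'a set \<Rightarrow> ('a \<times> real \<Rightarrow> real) \<Rightarrow> bool" where
  "viscosity_subsolution H S u \<longleftrightarrow>
     (\<forall>\<phi> D\<phi> \<phi>t x t. C1_test \<phi> D\<phi> \<phi>t \<and> x \<in> S \<and> t > 0 \<and>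
        eventually (\<lambda>z. u z - \<phi> z \<le> u (x, t) - \<phi> (x, t)) (at (x, t) within S \<times> {0<..})
        \<longrightarrow> \<phi>t (x, t) + H x (D\<phi> (x, t)) \<le> 0)"

definition viscosity_supersolution ::
  "('a::euclidean_space \<Rightarrow> 'a \<Rightarrow> real) \<Rightarrow> 'a set \<Rightarrow> ('a \<times> real \<Rightarrow> real) \<Rightarrow> bool" where
  "viscosity_supersolution H S u \<longleftrightarrow>
     (\<forall>\<phi> D\<phi> \<phi>t x t. C1_test \<phi> D\<phi> \<phi>t \<and> x \<in> S \<and> t > 0 \<and>
        eventually (\<lambda>z. u z - \<phi> z \<ge> u (x, t) - \<phi> (x, t)) (at (x, t) within S \<times> {0<..})
        \<longrightarrow> \<phi>t (x, t) + H x (D\<phi> (x, t)) \<ge> 0)"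

definition state_constraint_solution ::
  "('a::euclidean_space \<Rightarrow> 'a \<Rightarrow> real) \<Rightarrow> 'a set \<Rightarrow> ('a \<Rightarrow> real) \<Rightarrow> ('a \<times> real \<Rightarrow> real) \<Rightarrow> bool" where
  "state_constraint_solution H \<Omega> g u \<longleftrightarrow>
     continuous_on (closure \<Omega> \<times> {0..}) u \<and>
     viscosity_subsolution H \<Omega> u \<and>
     viscosity_supersolution H (closure \<Omega>) u \<and>
     (\<forall>x \<in> closure \<Omega>. u (x, 0) = g x)"

definition cauchy_solution ::
  "('a::euclidean_space \<Rightarrow> 'a \<Rightarrow> real) \<Rightarrow> ('a \<Rightarrow> real) \<Rightarrow> ('a \<times> real \<Rightarrow> real) \<Rightarrow> bool" where
  "cauchy_solution H g u \<longleftrightarrow>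
     continuous_on (UNIV \<times> {0..}) u \<and>
     viscosity_subsolution H UNIV u \<and>
     viscosity_supersolution H UNIV u \<and>
     (\<forall>x. u (x, 0) = g x)"

definition hole :: "(real^2) set" where
  "hole = ball 0 (1/4)"

definition perforated_plane :: "real \<Rightarrow> (real^2) set" where
  "perforated_plane r =
     UNIV - (\<Union>m \<in> {m. \<forall>i. m $ i \<in> \<int>}. (\<lambda>y. m + r *\<^sub>R y) ` closure hole)"

definition scaled_domain :: "(real \<Rightarrow> real) \<Rightarrow> real \<Rightarrow> (real^2) set" where
  "scaled_domain \<eta> \<epsilon> = (\<lambda>y. \<epsilon> *\<^sub>R y) ` perforated_plane (\<eta> \<epsilon>)"

text \<open>\<open>\<bar>s - of_int (round s)\<bar>\<close> is the distance of \<open>s\<close> to the nearest integer.\<close>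

definition coeff_a :: "real^2 \<Rightarrow> real" where
  "coeff_a y = 1 - \<bar>y $ 2 - of_int (round (y $ 2))\<bar>"

lemma coeff_a_eq: "coeff_a y = 1 - \<bar>y $ 2\<bar>" if "y $ 2 \<in> {-1/2..1/2}"
proof (cases "y $ 2 = 1/2")
  case True
  then have "round (y $ 2) = 1"
    unfolding round_def by linarith
  with True show ?thesis by (simp add: coeff_a_def)
next
  case False
  with that have "round (y $ 2) = 0"
    by (intro round_unique) auto
  then show ?thesis by (simp add: coeff_a_def)
qed

lemma coeff_a_periodic: "coeff_a (y + axis 2 1) = coeff_a y"
proof -
  have "round (y $ 2 + 1) = round (y $ 2) + 1"
    unfolding round_def by linarith
  then show ?thesis by (simp add: coeff_a_def axis_def)
qed

lemma coeff_a_depends: "coeff_a y = coeff_a z" if "y $ 2 = z $ 2"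
  using that by (simp add: coeff_a_def)

lemma coeff_a_lipschitz: "1-lipschitz_on UNIV coeff_a"
proof (rule lipschitz_onI)
  fix y z :: "real^2"
  have *: "\<bar>s - of_int (round s)\<bar> \<le> \<bar>s - t\<bar> + \<bar>t - of_int (round t)\<bar>" for s t :: real
    using round_diff_minimal[of s "round t"] by linarith
  have "\<bar>coeff_a y - coeff_a z\<bar> \<le> \<bar>(y - z) $ 2\<bar>"
    using *[of "y $ 2" "z $ 2"] *[of "z $ 2" "y $ 2"] unfolding coeff_a_def vector_minus_component
    by linarith
  also have "\<dots> \<le> norm (y - z)" by (rule component_le_norm_cart)
  finally show "dist (coeff_a y) (coeff_a z) \<le> 1 * dist y z"
    by (simp add: dist_norm)
qed simp

definition hamiltonian :: "real^2 \<Rightarrow> real^2 \<Rightarrow> real" where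
  "hamiltonian y p = coeff_a y * (norm p)\<^sup>2 / 2"

definition initial_g :: "real^2 \<Rightarrow> real" where
  "initial_g x = - (x $ 1)"

end

theory Submission
  imports Defs
begin

text \<open>Put \<open>r = \<eta> \<epsilon> / 4\<close>, the radius of the holes in the scale \<open>y = x / \<epsilon>\<close>. Without holes one may
  travel along \<open>x\<^sub>2 = 0\<close>, where \<open>a = 1\<close>; descending there from height \<open>\<epsilon> r\<close> costs \<open>\<epsilon>\<close> times a
  small constant, so the free solution is at most \<open>-1/2\<close> plus that cost. With holes, let
  \<open>s\<close> and \<open>h\<close> be the distances of \<open>y\<^sub>1\<close> and \<open>y\<^sub>2\<close> to the integers. Outside the holes
  \<open>s + h \<ge> r\<close>, hence \<open>a = 1 - h \<le> 1 - max 0 (r - s)\<close>, and an eikonal subsolution depending on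
  \<open>y\<^sub>1\<close> alone may be steeper by a factor \<open>1 + max 0 (r - s) / 2\<close>. This factor has mean
  \<open>1 + r\<^sup>2 / 2\<close>; normalising the mean slope to \<open>1\<close> lowers the effective Hamiltonian from \<open>1/2\<close> to
  \<open>1 / (2 (1 + r\<^sup>2 / 2)\<^sup>2)\<close>, which is the gain of order \<open>\<eta>\<^sup>2\<close>. Comparison with this subsolution needs no growth
  hypothesis: the subsolution property along paths avoiding the holes, run up to a large time,
  bounds the solution from below by \<open>- K - c |x|\<^sup>2\<close> with arbitrarily small \<open>c\<close>.\<close>

section \<open>Comparison with strict test functions on compact sets\<close>

text \<open>A negative minimum of \<open>u - \<phi>\<close> over \<open>K\<close> cannot lie in
  \<open>K - U\<close>. Since \<open>U\<close> is open and meets \<open>S \<times> {0<..}\<close>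
  only inside \<open>K\<close>, it is a local minimum relative to \<open>S \<times> {0<..}\<close>,
  and testing there contradicts strictness. For closed \<open>S\<close> the point may lie on the
  boundary of \<open>S\<close>, which is how the state constraint enters.\<close>

lemma supersolution_ge_test:
  fixes S :: "'a::euclidean_space set"
  assumes super: "viscosity_supersolution H S u" and test: "C1_test \<phi> D\<phi> \<phi>t"
    and K: "compact K" and U: "open U" "U \<inter> (S \<times> {0<..}) \<subseteq> K" "K \<inter> U \<subseteq> S \<times> {0<..}"
    and cont: "continuous_on K u" "continuous_on K \<phi>"
    and bd: "\<And>z. z \<in> K - U \<Longrightarrow> \<phi> z \<le> u z"
    and strict: "\<And>x t. (x, t) \<in> K \<inter> U \<Longrightarrow> \<phi>t (x, t) + H x (D\<phi> (x, t)) < 0"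
    and z: "z \<in> K"
  shows "\<phi> z \<le> u z"
proof (rule ccontr)
  assume "\<not> \<phi> z \<le> u z"
  have "continuous_on K (\<lambda>z. u z - \<phi> z)"
    using cont by (intro continuous_intros)
  then obtain w where w: "w \<in> K" "\<And>y. y \<in> K \<Longrightarrow> u w - \<phi> w \<le> u y - \<phi> y"
    using continuous_attains_inf[OF K] z by blast
  have "u w - \<phi> w < 0"
    using w(2)[OF z] \<open>\<not> \<phi> z \<le> u z\<close> by simp
  then have wU: "w \<in> U"
    using bd[of w] w(1) by force
  obtain x t where xt: "w = (x, t)" by fastforce
  have mem: "x \<in> S" "t > 0"
    using U(3) w(1) wU xt by auto
  have "eventually (\<lambda>y. y \<in> U \<and> y \<in> S \<times> {0<..}) (at (x, t) within S \<times> {0<..})"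
    using U(1) wU xt by (auto simp: eventually_at_topological)
  then have "eventually (\<lambda>y. u y - \<phi> y \<ge> u (x, t) - \<phi> (x, t)) (at (x, t) within S \<times> {0<..})"
    by eventually_elim (use w(2) U(2) xt in auto)
  then have "\<phi>t (x, t) + H x (D\<phi> (x, t)) \<ge> 0"
    using super test mem unfolding viscosity_supersolution_def by blast
  with strict[of x t] w(1) wU xt show False by auto
qed

lemma subsolution_le_test:
  fixes S :: "'a::euclidean_space set"
  assumes sub: "viscosity_subsolution H S u" and test: "C1_test \<phi> D\<phi> \<phi>t"
    and K: "compact K" and U: "open U" "U \<inter> (S \<times> {0<..}) \<subseteq> K" "K \<inter> U \<subseteq> S \<times> {0<..}"
    and cont: "continuous_on K u" "continuous_on K \<phi>"
    and bd: "\<And>z. z \<in> K - U \<Longrightarrow> u z \<le> \<phi> z"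
    and strict: "\<And>x t. (x, t) \<in> K \<inter> U \<Longrightarrow> \<phi>t (x, t) + H x (D\<phi> (x, t)) > 0"
    and z: "z \<in> K"
  shows "u z \<le> \<phi> z"
proof (rule ccontr)
  assume "\<not> u z \<le> \<phi> z"
  have "continuous_on K (\<lambda>z. u z - \<phi> z)"
    using cont by (intro continuous_intros)
  then obtain w where w: "w \<in> K" "\<And>y. y \<in> K \<Longrightarrow> u y - \<phi> y \<le> u w - \<phi> w"
    using continuous_attains_sup[OF K] z by blast
  have "u w - \<phi> w > 0"
    using w(2)[OF z] \<open>\<not> u z \<le> \<phi> z\<close> by simp
  then have wU: "w \<in> U"
    using bd[of w] w(1) by force
  obtain x t where xt: "w = (x, t)" by fastforce
  have mem: "x \<in> S" "t > 0"
    using U(3) w(1) wU xt by auto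
  have "eventually (\<lambda>y. y \<in> U \<and> y \<in> S \<times> {0<..}) (at (x, t) within S \<times> {0<..})"
    using U(1) wU xt by (auto simp: eventually_at_topological)
  then have "eventually (\<lambda>y. u y - \<phi> y \<le> u (x, t) - \<phi> (x, t)) (at (x, t) within S \<times> {0<..})"
    by eventually_elim (use w(2) U(2) xt in auto)
  then have "\<phi>t (x, t) + H x (D\<phi> (x, t)) \<le> 0"
    using sub test mem unfolding viscosity_subsolution_def by blast
  with strict[of x t] w(1) wU xt show False by auto
qed

section \<open>Building blocks of C^1 test functions\<close>

text \<open>Squared positive parts are C^1. Both the time penalties and the explicit primitive
  \<open>bump_int\<close> are built from them.\<close>

lemma has_real_derivative_max_0_squared:
  "((\<lambda>s. (max 0 s)\<^sup>2) has_real_derivative 2 * max 0 s) (at s)" for s :: real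
proof -
  consider "s < 0" | "s = 0" | "s > 0" by linarith
  then show ?thesis
  proof cases
    case 1
    have "((\<lambda>s. 0) has_real_derivative 0) (at s)" by simp
    then have "((\<lambda>s. (max 0 s)\<^sup>2) has_real_derivative 0) (at s)"
      by (rule has_field_derivative_transform_within_open[where S = "{..<0}"]) (use 1 in auto)
    with 1 show ?thesis by simp
  next
    case 2
    have "((\<lambda>h::real. (max 0 h)\<^sup>2 / h) \<longlongrightarrow> 0) (at 0)"
    proof (rule Lim_null_comparison)
      show "\<forall>\<^sub>F h::real in at 0. norm ((max 0 h)\<^sup>2 / h) \<le> \<bar>h\<bar>"
        by (rule always_eventually) (auto simp: max_def power2_eq_square)
      show "((\<lambda>h::real. \<bar>h\<bar>) \<longlongrightarrow> 0) (at 0)"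
        using tendsto_rabs[OF tendsto_ident_at, of 0 UNIV] by simp
    qed
    with 2 show ?thesis by (simp add: has_field_derivative_iff)
  next
    case 3
    have "((\<lambda>s. s\<^sup>2) has_real_derivative 2 * s) (at s)"
      by (auto intro!: derivative_eq_intros)
    then have "((\<lambda>s. (max 0 s)\<^sup>2) has_real_derivative 2 * s) (at s)"
      by (rule has_field_derivative_transform_within_open[where S = "{0<..}"]) (use 3 in auto)
    with 3 show ?thesis by simp
  qed
qed

lemma DERIV_max_0_squared [derivative_intros]:
  assumes "(g has_real_derivative g') (at x within A)"
  shows "((\<lambda>x. (max 0 (g x))\<^sup>2) has_real_derivative 2 * max 0 (g x) * g') (at x within A)"
  by (rule DERIV_chain2[OF has_real_derivative_max_0_squared assms])

lemma C1_test_add: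
  assumes "C1_test \<phi> D\<phi> \<phi>t" "C1_test \<psi> D\<psi> \<psi>t"
  shows "C1_test (\<lambda>z. \<phi> z + \<psi> z) (\<lambda>z. D\<phi> z + D\<psi> z) (\<lambda>z. \<phi>t z + \<psi>t z)"
  using assms unfolding C1_test_def
  by (auto intro!: continuous_intros simp: inner_add_left algebra_simps split_beta
      intro!: has_derivative_eq_rhs[OF has_derivative_add])

lemma C1_test_time:
  assumes "\<And>t. (f has_real_derivative f' t) (at t)" "continuous_on {0<..} f'"
  shows "C1_test (\<lambda>z. f (snd z)) (\<lambda>z. 0) (\<lambda>z. f' (snd z))"
  unfolding C1_test_def
proof (intro conjI ballI)
  fix z :: "'a::euclidean_space \<times> real"
  have "((\<lambda>z. f (snd z)) has_derivative (\<lambda>z'. f' (snd z) * snd z')) (at z)"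
    using assms(1)[of "snd z"]
    by (intro has_derivative_compose[of snd snd z UNIV f "\<lambda>h. f' (snd z) * h"])
      (auto simp: has_field_derivative_def intro!: derivative_eq_intros)
  then show "((\<lambda>z. f (snd z)) has_derivative (\<lambda>(h, k). 0 \<bullet> h + f' (snd z) * k)) (at z)"
    by (simp add: split_beta')
  show "continuous_on (UNIV \<times> {0<..}) (\<lambda>z::'a \<times> real. f' (snd z))"
    by (rule continuous_on_compose2[OF assms(2)]) (auto intro!: continuous_intros)
qed simp

lemma C1_test_moving_square:
  "C1_test (\<lambda>z. k * (norm (fst z - (y + snd z *\<^sub>R v)))\<^sup>2)
     (\<lambda>z. (2 * k) *\<^sub>R (fst z - (y + snd z *\<^sub>R v)))
     (\<lambda>z. - 2 * k * ((fst z - (y + snd z *\<^sub>R v)) \<bullet> v))"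
  unfolding C1_test_def power2_norm_eq_inner
  by (auto intro!: continuous_intros derivative_eq_intros
      simp: split_beta fun_eq_iff algebra_simps inner_commute)

section \<open>Propagation of subsolutions along segments\<close>

text \<open>The barrier is a steep paraboloid moving along the segment with velocity \<open>v\<close>; it is a
  strict supersolution because \<open>- p \<bullet> v + \<alpha> |p|\<^sup>2 / 2 \<ge> - |v|\<^sup>2 / (2 \<alpha>)\<close>. The term in
  \<open>max 0 (t - s')\<close> keeps the touching point away from the final time of the tube.\<close>

lemma subsolution_along_segment:
  fixes S :: "'a::euclidean_space set"
  assumes sub: "viscosity_subsolution H S u" and cont: "continuous_on (S \<times> {0..}) u"
    and B: "open B" "B \<subseteq> S" and \<alpha>: "\<alpha> > 0" "\<And>x p. x \<in> B \<Longrightarrow> H x p \<ge> \<alpha> * (norm p)\<^sup>2 / 2"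
    and seg: "closed_segment y x \<subseteq> B" and s: "0 \<le> s" "s < s'"
  shows "u (x, s') \<le> u (y, s) + (norm (x - y))\<^sup>2 / (2 * \<alpha> * (s' - s))"
proof -
  define v where "v = (x - y) /\<^sub>R (s' - s)"
  \<comment> \<open>The base point \<open>y - s *\<^sub>R v\<close> is the position extrapolated to
    time 0, which puts the barrier into the form of \<open>C1_test_moving_square\<close>.\<close>
  define \<xi> where "\<xi> t = (y - s *\<^sub>R v) + t *\<^sub>R v" for t
  have \<xi>': "\<xi> t = y + (t - s) *\<^sub>R v" for t
    unfolding \<xi>_def by (simp add: algebra_simps)
  have \<xi>s: "\<xi> s = y" "\<xi> s' = x"
    using s unfolding \<xi>' v_def by simp_all
  have \<xi>_seg: "\<xi> t \<in> closed_segment y x" if "s \<le> t" "t \<le> s'" for t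
  proof -
    have "\<xi> t = (1 - (t - s) / (s' - s)) *\<^sub>R y + ((t - s) / (s' - s)) *\<^sub>R x"
      unfolding \<xi>' v_def by (simp add: algebra_simps divide_inverse)
    then show ?thesis
      using that s unfolding in_segment by (intro exI[of _ "(t - s) / (s' - s)"]) auto
  qed
  obtain e where e: "e > 0" "(\<Union>z\<in>closed_segment y x. cball z e) \<subseteq> B"
    using compact_subset_open_imp_cball_epsilon_subset[OF compact_segment B(1) seg] by blast
  have bound: "u (x, s') \<le> u (y, s) + \<delta> + ((norm v)\<^sup>2 / (2 * \<alpha>) + \<delta>) * (s' - s)" if "\<delta> > 0" for \<delta>
  proof -
    have "y \<in> S" using seg B(2) by auto
    then obtain d where d: "d > 0"
      "\<And>z. z \<in> S \<times> {0..} \<Longrightarrow> dist z (y, s) < d \<Longrightarrow> dist (u z) (u (y, s)) < \<delta>"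
      using cont s \<open>\<delta> > 0\<close> unfolding continuous_on_iff
      by (metis SigmaI atLeast_iff)
    \<comment> \<open>A radius of at most \<open>e / 2\<close> keeps the tube in \<open>B\<close>
      even when its centre is off the segment by \<open>\<rho>\<close>; a radius below
      \<open>d\<close> keeps \<open>u\<close> within \<open>\<delta>\<close> of
      \<open>u (y, s)\<close> on the bottom disc.\<close>
    define \<rho> where "\<rho> = min (e / 2) (d / 2)"
    have \<rho>: "\<rho> > 0" "2 * \<rho> \<le> e" "\<rho> < d" using e d by (auto simp: \<rho>_def)
    \<comment> \<open>Until time \<open>s' + \<sigma>\<close> the centre overshoots \<open>x\<close>
      by at most \<open>\<rho>\<close>; the \<open>+ 1\<close> covers \<open>v = 0\<close>.\<close>
    define \<sigma> where "\<sigma> = \<rho> / (norm v + 1)"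
    have "\<sigma> > 0" using \<rho> by (auto simp: \<sigma>_def intro!: divide_pos_pos add_nonneg_pos)
    have \<sigma>v: "\<sigma> * norm v \<le> \<rho>"
    proof -
      have "\<sigma> * norm v \<le> \<sigma> * (norm v + 1)" using \<open>\<sigma> > 0\<close> by simp
      also have "\<dots> = \<rho>" unfolding \<sigma>_def by (simp add: add_nonneg_eq_0_iff)
      finally show ?thesis .
    qed
    have tube: "z \<in> B" if "s \<le> t" "t \<le> s' + \<sigma>" "norm (z - \<xi> t) \<le> \<rho>" for z t
    proof -
      define t' where "t' = min t s'"
      have "norm (\<xi> t - \<xi> t') = \<bar>t - t'\<bar> * norm v"
        unfolding \<xi>_def by (simp flip: scaleR_diff_left)
      also have "\<dots> \<le> \<sigma> * norm v"
        using that \<open>\<sigma> > 0\<close> by (intro mult_right_mono) (auto simp: t'_def)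
      finally have "norm (z - \<xi> t') \<le> e"
        using that \<sigma>v \<rho> norm_triangle_ineq[of "z - \<xi> t" "\<xi> t - \<xi> t'"] by simp
      moreover have "\<xi> t' \<in> closed_segment y x"
        using that s by (intro \<xi>_seg) (auto simp: t'_def)
      ultimately show ?thesis
        using e(2) by (force simp: dist_norm norm_minus_commute)
    qed
    define g where "g z = fst z - \<xi> (snd z)" for z
    have cg: "continuous_on A g" for A
      unfolding g_def \<xi>_def by (intro continuous_intros)
    define K where "K = (\<lambda>z. (\<xi> (snd z) + fst z, snd z)) ` (cball 0 \<rho> \<times> {s..s' + \<sigma>})"
    have K_iff: "z \<in> K \<longleftrightarrow> norm (g z) \<le> \<rho> \<and> s \<le> snd z \<and> snd z \<le> s' + \<sigma>" for z
    proof
      assume "norm (g z) \<le> \<rho> \<and> s \<le> snd z \<and> snd z \<le> s' + \<sigma>"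
      then show "z \<in> K"
        unfolding K_def by (intro image_eqI[of _ _ "(g z, snd z)"]) (auto simp: g_def)
    qed (auto simp: K_def g_def)
    have "compact K"
      unfolding K_def \<xi>_def
      by (intro compact_continuous_image continuous_intros compact_Times) auto
    have KB: "K \<subseteq> B \<times> {0..}"
      using tube s unfolding K_iff subset_iff g_def by (auto simp: mem_Times_iff)
    have cK: "continuous_on K u"
      using KB B(2) by (intro continuous_on_subset[OF cont]) auto
    then have "bounded (u ` K)"
      using \<open>compact K\<close> compact_continuous_image compact_imp_bounded by blast
    then obtain M where M: "\<And>z. z \<in> K \<Longrightarrow> \<bar>u z\<bar> \<le> M"
      unfolding bounded_iff by auto
    have ysK: "(y, s) \<in> K"
      using \<xi>s s \<rho> \<open>\<sigma> > 0\<close> by (simp add: K_iff g_def)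
    have "M \<ge> 0" using M[OF ysK] by simp
    define U where "U = {z. norm (g z) < \<rho> \<and> s < snd z \<and> snd z < s' + \<sigma>}"
    have "open U"
      unfolding U_def g_def \<xi>_def by (intro open_Collect_conj open_Collect_less continuous_intros)
    \<comment> \<open>\<open>2 * M\<close> bounds the oscillation of \<open>u\<close> on
      \<open>K\<close>. With these \<open>k\<close> and \<open>N\<close> the paraboloid reaches that
      value on the lateral boundary and the time penalty reaches it at the final time.\<close>
    define k where "k = 2 * M / \<rho>\<^sup>2"
    have "k \<ge> 0" using \<open>M \<ge> 0\<close> by (simp add: k_def)
    define N where "N = 2 * M / \<sigma>\<^sup>2"
    have "N \<ge> 0" using \<open>M \<ge> 0\<close> by (simp add: N_def)
    \<comment> \<open>The first \<open>\<delta>\<close> pays for the oscillation on the bottom disc,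
      the \<open>\<delta>\<close> in the slope makes the supersolution strict.\<close>
    define f where "f t = u (y, s) + \<delta> + ((norm v)\<^sup>2 / (2 * \<alpha>) + \<delta>) * (t - s)
      + N * (max 0 (t - s'))\<^sup>2" for t
    define f' where "f' t = ((norm v)\<^sup>2 / (2 * \<alpha>) + \<delta>) + N * (2 * max 0 (t - s'))" for t
    have f_deriv: "(f has_real_derivative f' t) (at t)" for t
      unfolding f_def f'_def
      by (auto intro!: derivative_eq_intros)
    have cf: "continuous_on A f" "continuous_on A f'" for A
      unfolding f_def f'_def by (intro continuous_intros)+
    let ?\<phi> = "\<lambda>z. k * (norm (fst z - ((y - s *\<^sub>R v) + snd z *\<^sub>R v)))\<^sup>2 + f (snd z)"
    have \<phi>: "?\<phi> z = k * (norm (g z))\<^sup>2 + f (snd z)" for z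
      by (simp add: g_def \<xi>_def)
    have "u (x, s') \<le> ?\<phi> (x, s')"
    proof (rule subsolution_le_test[OF sub C1_test_add[OF C1_test_moving_square C1_test_time[OF f_deriv cf(2)]]
          \<open>compact K\<close> \<open>open U\<close> _ _ cK])
      show "U \<inter> S \<times> {0<..} \<subseteq> K" by (auto simp: U_def K_iff)
      show "K \<inter> U \<subseteq> S \<times> {0<..}" using KB B(2) s by (auto simp: U_def)
      show "continuous_on K ?\<phi>"
        by (intro continuous_intros continuous_on_compose2[OF cf(1), where t = UNIV]) auto
      show "(x, s') \<in> K" using s \<xi>s \<rho> \<open>\<sigma> > 0\<close> by (simp add: K_iff g_def)
    next
      fix z assume z: "z \<in> K - U"
      have uz: "u z - u (y, s) \<le> 2 * M"
        using M[OF ysK] M[of z] z by auto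
      have fz: "f (snd z) \<ge> u (y, s) + \<delta> + N * (max 0 (snd z - s'))\<^sup>2"
        using z \<open>\<delta> > 0\<close> \<alpha>(1) unfolding f_def by (simp add: K_iff)
      have kz: "k * (norm (g z))\<^sup>2 \<ge> 0" using \<open>k \<ge> 0\<close> by simp
      have Mz: "N * (max 0 (snd z - s'))\<^sup>2 \<ge> 0" using \<open>N \<ge> 0\<close> by simp
      consider "snd z = s" | "norm (g z) = \<rho>" | "snd z = s' + \<sigma>"
        using z unfolding U_def by (fastforce simp: K_iff)
      then show "u z \<le> ?\<phi> z"
      proof cases
        case 1
        then have "dist z (y, s) < d"
          using z \<rho> \<xi>s by (auto simp: K_iff g_def dist_prod_def dist_norm)
        then have "dist (u z) (u (y, s)) < \<delta>"
          using d(2)[of z] z KB B(2) by blast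
        then show ?thesis using fz kz Mz unfolding \<phi> dist_real_def by linarith
      next
        case 2
        then have "k * (norm (g z))\<^sup>2 = 2 * M" using \<rho> by (simp add: k_def)
        then show ?thesis using fz Mz uz \<open>\<delta> > 0\<close> unfolding \<phi> by linarith
      next
        case 3
        then have "N * (max 0 (snd z - s'))\<^sup>2 = 2 * M" using \<open>\<sigma> > 0\<close> by (simp add: N_def)
        then show ?thesis using fz kz uz \<open>\<delta> > 0\<close> unfolding \<phi> by linarith
      qed
    next
      fix z t assume zt: "(z, t) \<in> K \<inter> U"
      define p where "p = (2 * k) *\<^sub>R g (z, t)"
      have "H z p \<ge> \<alpha> * (norm p)\<^sup>2 / 2"
        using zt KB by (intro \<alpha>(2)) auto
      moreover have "f' t \<ge> (norm v)\<^sup>2 / (2 * \<alpha>) + \<delta>"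
        using \<open>N \<ge> 0\<close> by (simp add: f'_def)
      \<comment> \<open>Completing the square in \<open>p\<close> gives the inequality between
        \<open>H\<close> and its Legendre dual.\<close>
      moreover have "0 \<le> (norm (\<alpha> *\<^sub>R p - v))\<^sup>2 / (2 * \<alpha>)"
        using \<alpha>(1) by simp
      moreover have "(norm (\<alpha> *\<^sub>R p - v))\<^sup>2 / (2 * \<alpha>)
          = \<alpha> * (norm p)\<^sup>2 / 2 - p \<bullet> v + (norm v)\<^sup>2 / (2 * \<alpha>)"
        using \<alpha>(1) unfolding power2_norm_eq_inner
        by (simp add: inner_diff inner_commute field_simps power2_eq_square)
      ultimately have "f' t - p \<bullet> v + H z p > 0"
        using \<open>\<delta> > 0\<close> by linarith
      then show "0 < - 2 * k * ((fst (z, t) - (y - s *\<^sub>R v + snd (z, t) *\<^sub>R v)) \<bullet> v) + f' (snd (z, t)) +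
          H z ((2 * k) *\<^sub>R (fst (z, t) - (y - s *\<^sub>R v + snd (z, t) *\<^sub>R v)) + 0)"
        by (simp add: p_def g_def \<xi>_def)
    qed
    also have "\<dots> = u (y, s) + \<delta> + ((norm v)\<^sup>2 / (2 * \<alpha>) + \<delta>) * (s' - s)"
      using \<xi>s unfolding \<phi> by (simp add: g_def f_def)
    finally show ?thesis .
  qed
  have "u (x, s') \<le> u (y, s) + (norm v)\<^sup>2 / (2 * \<alpha>) * (s' - s) + c" if "c > 0" for c
  proof -
    define \<delta> where "\<delta> = c / (1 + (s' - s))"
    have "\<delta> > 0" and \<delta>: "\<delta> + \<delta> * (s' - s) = c"
    proof -
      have "\<delta> * (1 + (s' - s)) = c" using s by (simp add: \<delta>_def)
      then show "\<delta> + \<delta> * (s' - s) = c" by (simp add: distrib_left)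
    qed (use that s in \<open>simp add: \<delta>_def\<close>)
    then show ?thesis using bound[of \<delta>] by (simp add: distrib_right)
  qed
  then have "u (x, s') \<le> u (y, s) + (norm v)\<^sup>2 / (2 * \<alpha>) * (s' - s)"
    by (rule field_le_epsilon)
  also have "(norm v)\<^sup>2 / (2 * \<alpha>) * (s' - s) = (norm (x - y))\<^sup>2 / (2 * \<alpha> * (s' - s))"
  proof -
    have "norm v = norm (x - y) / (s' - s)"
      using s by (simp add: v_def divide_inverse mult.commute)
    moreover have "(a / c)\<^sup>2 / (2 * \<alpha>) * c = a\<^sup>2 / (2 * \<alpha> * c)" if "c \<noteq> 0" for a c :: real
      using that \<alpha>(1) by (simp add: power2_eq_square)
    ultimately show ?thesis using s by simp
  qed
  finally show ?thesis .
qed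


section \<open>Lattice distance and the geometry of the perforated domain\<close>

definition int_dist :: "real \<Rightarrow> real" where
  "int_dist s = \<bar>s - of_int (round s)\<bar>"

text \<open>The square of the Euclidean distance to the lattice Z^2; the minimisation separates over
  the coordinates.\<close>

definition lattice_dist2 :: "real^2 \<Rightarrow> real" where
  "lattice_dist2 y = (int_dist (y $ 1))\<^sup>2 + (int_dist (y $ 2))\<^sup>2"

lemma coeff_a_int_dist: "coeff_a y = 1 - int_dist (y $ 2)"
  by (simp add: coeff_a_def int_dist_def)

lemma int_dist_le: "int_dist s \<le> \<bar>s - of_int k\<bar>"
  unfolding int_dist_def by (rule round_diff_minimal)

lemma int_dist_nonneg [simp]: "int_dist s \<ge> 0"
  by (simp add: int_dist_def)

lemma int_dist_le_half: "int_dist s \<le> 1/2"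
  using of_int_round_abs_le[of s] by (simp add: int_dist_def abs_minus_commute)

lemma int_dist_add: "\<bar>d\<bar> \<le> 1/2 \<Longrightarrow> int_dist (of_int m + d) = \<bar>d\<bar>"
proof (rule antisym)
  assume d: "\<bar>d\<bar> \<le> 1/2"
  show "int_dist (of_int m + d) \<le> \<bar>d\<bar>"
    using int_dist_le[of "of_int m + d" m] by simp
  show "\<bar>d\<bar> \<le> int_dist (of_int m + d)"
  proof (cases "round (of_int m + d) = m")
    case False
    then have "\<bar>of_int m - of_int (round (of_int m + d)) :: real\<bar> \<ge> 1"
      by linarith
    with d show ?thesis unfolding int_dist_def by linarith
  qed (simp add: int_dist_def)
qed

lemma int_dist_diff: "\<bar>int_dist s - int_dist t\<bar> \<le> \<bar>s - t\<bar>"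
  using int_dist_le[of s "round t"] int_dist_le[of t "round s"] unfolding int_dist_def by linarith

lemma continuous_on_int_dist [continuous_intros]:
  "continuous_on A f \<Longrightarrow> continuous_on A (\<lambda>x. int_dist (f x))"
proof (rule continuous_on_compose2[of UNIV int_dist])
  have "1-lipschitz_on UNIV int_dist"
    by (rule lipschitz_onI) (use int_dist_diff in \<open>auto simp: dist_real_def\<close>)
  then show "continuous_on UNIV int_dist" by (rule lipschitz_on_continuous_on)
qed auto

lemma continuous_on_lattice_dist2 [continuous_intros]:
  "continuous_on A f \<Longrightarrow> continuous_on A (\<lambda>x. lattice_dist2 (f x))"
  unfolding lattice_dist2_def by (intro continuous_intros)

lemma lattice_dist2_scaleR_inverse:
  "lattice_dist2 (x /\<^sub>R \<epsilon>) = (int_dist (x $ 1 / \<epsilon>))\<^sup>2 + (int_dist (x $ 2 / \<epsilon>))\<^sup>2"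
  by (simp add: lattice_dist2_def divide_inverse mult.commute)

lemma norm_vec2_squared: "(norm x)\<^sup>2 = (x $ 1)\<^sup>2 + (x $ 2)\<^sup>2" for x :: "real^2"
  unfolding power2_norm_eq_inner by (simp add: inner_vec_def sum_2 power2_eq_square)

text \<open>Rounding both coordinates yields a nearest lattice point, so the hole around that point
  alone decides whether \<open>y\<close> has been removed.\<close>

lemma in_perforated_plane_iff:
  assumes "r \<ge> 0"
  shows "y \<in> perforated_plane r \<longleftrightarrow> (r / 4)\<^sup>2 < lattice_dist2 y"
proof -
  have cb: "closure hole = cball 0 (1/4)" unfolding hole_def by simp
  have *: "y \<in> (\<lambda>y. m + r *\<^sub>R y) ` closure hole \<longleftrightarrow> norm (y - m) \<le> r / 4" for m
  proof (cases "r = 0")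
    case True
    then show ?thesis by (auto simp: cb image_constant_conv)
  next
    case False
    show ?thesis
    proof
      assume "norm (y - m) \<le> r / 4"
      then show "y \<in> (\<lambda>y. m + r *\<^sub>R y) ` closure hole"
        using False assms by (intro image_eqI[of _ _ "(y - m) /\<^sub>R r"]) (auto simp: cb divide_inverse_commute[symmetric] divide_simps mult.commute)
    next
      assume "y \<in> (\<lambda>y. m + r *\<^sub>R y) ` closure hole"
      then obtain w where "norm w \<le> 1/4" "y - m = r *\<^sub>R w" by (auto simp: cb)
      then show "norm (y - m) \<le> r / 4"
        using assms mult_left_mono[of "norm w" "1/4" r] by simp
    qed
  qed
  have norm_le: "norm (y - m) \<le> r / 4 \<longleftrightarrow> (y $ 1 - m $ 1)\<^sup>2 + (y $ 2 - m $ 2)\<^sup>2 \<le> (r / 4)\<^sup>2" for m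
    using assms norm_vec2_squared[of "y - m"] by (metis abs_le_square_iff abs_norm_cancel
        abs_of_nonneg divide_nonneg_nonneg vector_minus_component zero_le_numeral)
  show ?thesis
  proof
    assume "y \<in> perforated_plane r"
    moreover have "\<forall>i. (vector [of_int (round (y $ 1)), of_int (round (y $ 2))] :: real^2) $ i \<in> \<int>"
      by (simp add: forall_2)
    ultimately show "(r / 4)\<^sup>2 < lattice_dist2 y"
      unfolding perforated_plane_def lattice_dist2_def int_dist_def
      using * norm_le by (force simp: not_le)
  next
    assume lt: "(r / 4)\<^sup>2 < lattice_dist2 y"
    have "\<not> norm (y - m) \<le> r / 4" if "\<forall>i. m $ i \<in> \<int>" for m
    proof -
      obtain k l :: int where "m $ 1 = of_int k" "m $ 2 = of_int l"
        using \<open>\<forall>i. m $ i \<in> \<int>\<close> by (meson Ints_cases)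
      moreover have "lattice_dist2 y \<le> (y $ 1 - of_int k)\<^sup>2 + (y $ 2 - of_int l)\<^sup>2"
        unfolding lattice_dist2_def
        using int_dist_le by (intro add_mono) (auto simp: abs_le_square_iff[symmetric])
      ultimately show ?thesis using lt unfolding norm_le by simp
    qed
    then show "y \<in> perforated_plane r"
      unfolding perforated_plane_def using * by blast
  qed
qed

lemma scaled_domain_eq:
  assumes "\<epsilon> > 0" "\<eta> \<epsilon> \<ge> 0"
  shows "scaled_domain \<eta> \<epsilon> = {x. (\<eta> \<epsilon> / 4)\<^sup>2 < lattice_dist2 (x /\<^sub>R \<epsilon>)}"
proof -
  have "x \<in> scaled_domain \<eta> \<epsilon> \<longleftrightarrow> x /\<^sub>R \<epsilon> \<in> perforated_plane (\<eta> \<epsilon>)" for x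
    using assms(1) unfolding scaled_domain_def
    by (auto intro!: image_eqI[of _ _ "x /\<^sub>R \<epsilon>"])
  then show ?thesis using in_perforated_plane_iff[OF assms(2)] by auto
qed

lemma open_scaled_domain:
  assumes "\<epsilon> > 0" "\<eta> \<epsilon> \<ge> 0"
  shows "open (scaled_domain \<eta> \<epsilon>)"
  unfolding scaled_domain_eq[of \<epsilon> \<eta>, OF assms] by (intro open_Collect_less continuous_intros)

lemma closure_scaled_domain_subset:
  assumes "\<epsilon> > 0" "\<eta> \<epsilon> \<ge> 0"
  shows "closure (scaled_domain \<eta> \<epsilon>) \<subseteq> {x. (\<eta> \<epsilon> / 4)\<^sup>2 \<le> lattice_dist2 (x /\<^sub>R \<epsilon>)}"
  by (rule closure_minimal) (auto simp: scaled_domain_eq[of \<epsilon> \<eta>, OF assms]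
      intro!: closed_Collect_le continuous_intros)

lemma coeff_a_bounds: "1/2 \<le> coeff_a y" "coeff_a y \<le> 1"
  using int_dist_le_half[of "y $ 2"] by (auto simp: coeff_a_int_dist)

section \<open>Quadratic lower bound with arbitrarily small coefficient\<close>

text \<open>The path runs forward from \<open>(x, t)\<close> to a fixed \<open>(b, T)\<close>, so
  the upper bound of \<open>u (b, T)\<close> by \<open>u (x, t)\<close> plus the cost of the path is
  a lower bound for \<open>u (x, t)\<close>. The cost is quadratic in the length and inversely
  proportional to the available time.\<close>

lemma subsolution_growth:
  assumes \<epsilon>: "0 < \<epsilon>" "\<epsilon> \<le> 1" and \<eta>: "0 \<le> \<eta> \<epsilon>" "\<eta> \<epsilon> < 1"
    and sub: "viscosity_subsolution (\<lambda>x. hamiltonian (x /\<^sub>R \<epsilon>)) (scaled_domain \<eta> \<epsilon>) u"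
    and cont: "continuous_on (closure (scaled_domain \<eta> \<epsilon>) \<times> {0..}) u" and "c > 0"
  shows "\<exists>K\<ge>0. \<forall>x\<in>closure (scaled_domain \<eta> \<epsilon>). \<forall>t\<in>{0..2}. u (x, t) \<ge> - K - c * (norm x)\<^sup>2"
proof -
  let ?\<Omega> = "scaled_domain \<eta> \<epsilon>"
  have step: "u (x, s') \<le> u (y, s) + (norm (x - y))\<^sup>2 / (s' - s)"
    if "closed_segment y x \<subseteq> ?\<Omega>" "0 \<le> s" "s < s'" for x y s s'
  proof -
    have "u (x, s') \<le> u (y, s) + (norm (x - y))\<^sup>2 / (2 * (1/2) * (s' - s))"
    proof (rule subsolution_along_segment[OF sub _ open_scaled_domain[of \<epsilon> \<eta>, OF \<epsilon>(1) \<eta>(1)]])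
      show "continuous_on (?\<Omega> \<times> {0..}) u"
        using closure_subset by (intro continuous_on_subset[OF cont]) fastforce
      show "1/2 * (norm p)\<^sup>2 / 2 \<le> hamiltonian (x /\<^sub>R \<epsilon>) p" for x p
        unfolding hamiltonian_def using coeff_a_bounds
        by (intro divide_right_mono mult_right_mono) auto
    qed (use that \<epsilon> \<eta> in auto)
    then show ?thesis by simp
  qed
  have rsq: "(\<eta> \<epsilon> / 4)\<^sup>2 < (1/2)\<^sup>2"
    using \<eta> by (intro power_strict_mono) auto
  have half: "x \<in> ?\<Omega>" if "x $ i / \<epsilon> = of_int k + 1/2" for x k i
  proof -
    have *: "(1/2)\<^sup>2 = (int_dist (x $ i / \<epsilon>))\<^sup>2"
      unfolding that using int_dist_add[of "1/2" k] by simp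
    have "(1/2)\<^sup>2 \<le> lattice_dist2 (x /\<^sub>R \<epsilon>)"
      using exhaust_2[of i] unfolding lattice_dist2_scaleR_inverse * by auto
    with rsq show ?thesis using scaled_domain_eq[of \<epsilon> \<eta>, OF \<epsilon>(1) \<eta>(1)] by simp
  qed
  define b :: "real^2" where "b = vector [\<epsilon> / 2, \<epsilon> / 2]"
  \<comment> \<open>Each of the three legs gets the time \<open>(T - t) / 3\<close>, which is at
    least \<open>6 / c\<close> for all \<open>t \<le> 2\<close>.\<close>
  define T where "T = 2 + 18 / c"
  \<comment> \<open>The extra \<open>c\<close> is the constant term of the total cost
    \<open>c * L\<^sup>2 / 2 \<le> c * (norm x)\<^sup>2 + c\<close>, where
    \<open>L = norm x + 1\<close>.\<close>
  define K where "K = \<bar>u (b, T)\<bar> + c"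
  have interior: "u (x, t) + c * (norm x)\<^sup>2 \<ge> - K" if x: "x \<in> ?\<Omega>" and t: "t \<in> {0..2}" for x t
  proof -
    define m where "m = round (x $ 2 / \<epsilon>)"
    define d where "d = x $ 2 / \<epsilon> - of_int m"
    have d: "\<bar>d\<bar> \<le> 1/2"
      using int_dist_le_half unfolding d_def m_def int_dist_def by blast
    have x2: "x $ 2 = \<epsilon> * (of_int m + d)"
      using \<epsilon> by (simp add: d_def)
    define k where "k = (if d \<ge> 0 then m else m - 1)"
    define h where "h = \<epsilon> * (of_int k + 1/2)"
    define p :: "real^2" where "p = vector [x $ 1, h]"
    define q :: "real^2" where "q = vector [\<epsilon> / 2, h]"
    \<comment> \<open>The path leaves \<open>x\<close> vertically, away from the nearest hole, up to a half-integer
      height; the lines with a half-integer coordinate avoid all holes.\<close>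
    have xp: "closed_segment x p \<subseteq> ?\<Omega>"
    proof
      fix z assume "z \<in> closed_segment x p"
      then obtain l where l: "0 \<le> l" "l \<le> 1" "z = (1 - l) *\<^sub>R x + l *\<^sub>R p"
        by (auto simp: in_segment)
      \<comment> \<open>\<open>d'\<close> is the signed vertical offset of \<open>z\<close> from row
        \<open>m\<close>; along the leg its modulus grows from \<open>\<bar>d\<bar>\<close> to
        \<open>1/2\<close>.\<close>
      define d' where "d' = (1 - l) * d + l * (if d \<ge> 0 then 1/2 else - 1/2)"
      have z2: "z $ 2 / \<epsilon> = of_int m + d'" and z1: "z $ 1 = x $ 1"
        using \<epsilon> unfolding l(3) d'_def p_def h_def k_def by (auto simp: x2 field_simps)
      have d': "\<bar>d\<bar> \<le> \<bar>d'\<bar>" "\<bar>d'\<bar> \<le> 1/2"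
      proof -
        have "\<bar>d'\<bar> = (1 - l) * \<bar>d\<bar> + l * (1/2)"
        proof -
          have "0 \<le> (1 - l) * \<bar>d\<bar> + l * (1/2)" using l(1,2) by simp
          moreover have "d' = (1 - l) * \<bar>d\<bar> + l * (1/2) \<or> d' = - ((1 - l) * \<bar>d\<bar> + l * (1/2))"
            unfolding d'_def by (cases "d \<ge> 0") (simp_all add: algebra_simps)
          ultimately show ?thesis by linarith
        qed
        moreover have "l * \<bar>d\<bar> \<le> l * (1/2)" "(1 - l) * \<bar>d\<bar> \<le> (1 - l) * (1/2)"
          using d l by (intro mult_left_mono; simp)+
        ultimately show "\<bar>d\<bar> \<le> \<bar>d'\<bar>" "\<bar>d'\<bar> \<le> 1/2" by (simp_all add: algebra_simps)
      qed
      have "int_dist (x $ 2 / \<epsilon>) \<le> int_dist (z $ 2 / \<epsilon>)"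
        using int_dist_add[OF d'(2), of m] int_dist_add[OF d, of m] d' \<epsilon> unfolding z2 x2 by simp
      then have "lattice_dist2 (x /\<^sub>R \<epsilon>) \<le> lattice_dist2 (z /\<^sub>R \<epsilon>)"
        unfolding lattice_dist2_scaleR_inverse z1 by (intro add_left_mono power_mono) auto
      then show "z \<in> ?\<Omega>"
        using x unfolding scaled_domain_eq[of \<epsilon> \<eta>, OF \<epsilon>(1) \<eta>(1)] by simp
    qed
    have pq: "closed_segment p q \<subseteq> ?\<Omega>"
    proof
      fix z assume "z \<in> closed_segment p q"
      then have "z $ 2 = h" by (auto simp: in_segment p_def q_def simp flip: distrib_right)
      then show "z \<in> ?\<Omega>" using \<epsilon> by (intro half[of z 2 k]) (simp add: h_def)
    qed
    have qb: "closed_segment q b \<subseteq> ?\<Omega>"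
    proof
      fix z assume "z \<in> closed_segment q b"
      then have "z $ 1 = \<epsilon> / 2" by (auto simp: in_segment q_def b_def simp flip: distrib_right)
      then show "z \<in> ?\<Omega>" using \<epsilon> by (intro half[of z 1 0]) simp
    qed
    define L where "L = norm x + 1"
    have xL: "\<bar>x $ 1\<bar> \<le> L - 1" "\<bar>x $ 2\<bar> \<le> L - 1"
      using component_le_norm_cart[of x] by (simp_all add: L_def)
    have hx: "\<bar>h - x $ 2\<bar> \<le> \<epsilon> / 2"
    proof -
      have "h - x $ 2 = \<epsilon> * (of_int k + 1/2 - of_int m - d)"
        unfolding h_def x2 by (simp add: algebra_simps)
      moreover have "\<bar>of_int k + 1/2 - of_int m - d\<bar> \<le> 1/2"
        using d unfolding k_def by auto
      ultimately show ?thesis using \<epsilon> by (simp add: abs_mult)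
    qed
    have "(norm (p - x))\<^sup>2 = (h - x $ 2)\<^sup>2" "(norm (q - p))\<^sup>2 = (\<epsilon> / 2 - x $ 1)\<^sup>2" "(norm (b - q))\<^sup>2 = (\<epsilon> / 2 - h)\<^sup>2"
      unfolding norm_vec2_squared p_def q_def b_def by simp_all
    moreover have "\<bar>h - x $ 2\<bar> \<le> L" "\<bar>\<epsilon> / 2 - x $ 1\<bar> \<le> L" "\<bar>\<epsilon> / 2 - h\<bar> \<le> L"
      using hx xL \<epsilon> by linarith+
    moreover have "a\<^sup>2 \<le> L\<^sup>2" if "\<bar>a\<bar> \<le> L" for a
      using that by (simp flip: abs_le_square_iff)
    ultimately have len: "(norm (p - x))\<^sup>2 \<le> L\<^sup>2" "(norm (q - p))\<^sup>2 \<le> L\<^sup>2" "(norm (b - q))\<^sup>2 \<le> L\<^sup>2"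
      by simp_all
    define \<Delta> where "\<Delta> = (T - t) / 3"
    have \<Delta>: "\<Delta> \<ge> 6 / c"
      using t by (simp add: \<Delta>_def T_def)
    have "\<Delta> > 0" using \<Delta> \<open>c > 0\<close> by (meson divide_pos_pos less_le_trans zero_less_numeral)
    have cost: "l / \<Delta> \<le> c * L\<^sup>2 / 6" if "l \<le> L\<^sup>2" for l
    proof -
      have "l / \<Delta> \<le> L\<^sup>2 / \<Delta>" using that \<open>\<Delta> > 0\<close> by (simp add: divide_right_mono)
      also have "\<dots> \<le> L\<^sup>2 / (6 / c)"
        using \<Delta> \<open>\<Delta> > 0\<close> \<open>c > 0\<close> by (intro divide_left_mono) auto
      finally show ?thesis by (simp add: mult.commute)
    qed
    have hop: "u (x', t' + \<Delta>) \<le> u (y, t') + c * L\<^sup>2 / 6"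
      if "closed_segment y x' \<subseteq> ?\<Omega>" "(norm (x' - y))\<^sup>2 \<le> L\<^sup>2" "0 \<le> t'" for x' y t'
    proof -
      have "u (x', t' + \<Delta>) \<le> u (y, t') + (norm (x' - y))\<^sup>2 / \<Delta>"
        using step[OF that(1), of t' "t' + \<Delta>"] that(3) \<open>\<Delta> > 0\<close> by simp
      with cost[OF that(2)] show ?thesis by linarith
    qed
    have "3 * \<Delta> = T - t" by (simp add: \<Delta>_def)
    then have "t + \<Delta> + \<Delta> + \<Delta> = T" by linarith
    then have "u (b, T) \<le> u (q, t + \<Delta> + \<Delta>) + c * L\<^sup>2 / 6"
      using hop[OF qb len(3), of "t + \<Delta> + \<Delta>"] t \<open>\<Delta> > 0\<close> by simp
    moreover have "u (p, t + \<Delta>) \<le> u (x, t) + c * L\<^sup>2 / 6"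
      using hop[OF xp len(1)] t by simp
    moreover have "u (q, t + \<Delta> + \<Delta>) \<le> u (p, t + \<Delta>) + c * L\<^sup>2 / 6"
      using hop[OF pq len(2), of "t + \<Delta>"] t \<open>\<Delta> > 0\<close> by simp
    moreover have "c * L\<^sup>2 / 2 \<le> c * (norm x)\<^sup>2 + c"
    proof -
      have "L\<^sup>2 \<le> 2 * (norm x)\<^sup>2 + 2"
        using zero_le_power2[of "norm x - 1"] by (simp add: L_def power2_eq_square algebra_simps)
      then show ?thesis using \<open>c > 0\<close> mult_left_mono[of "L\<^sup>2" "2 * (norm x)\<^sup>2 + 2" c]
        by (simp add: algebra_simps)
    qed
    ultimately show ?thesis unfolding K_def by linarith
  qed
  \<comment> \<open>The paths live in the open domain, where the subsolution property holds;
    boundary points follow by continuity in \<open>x\<close> at fixed time.\<close>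
  have "u (x, t) + c * (norm x)\<^sup>2 \<ge> - K" if x: "x \<in> closure ?\<Omega>" and t: "t \<in> {0..2}" for x t
  proof (rule continuous_ge_on_closure[OF _ x])
    show "continuous_on (closure ?\<Omega>) (\<lambda>x. u (x, t) + c * (norm x)\<^sup>2)"
      using t by (intro continuous_intros continuous_on_compose2[OF cont]) auto
  qed (use interior t in auto)
  moreover have "K \<ge> 0" using \<open>c > 0\<close> by (simp add: K_def)
  ultimately show ?thesis by (intro exI[of _ K]) (auto simp: algebra_simps)
qed


section \<open>The periodic corrector and its slope\<close>

text \<open>Half of a tent of height and half-width \<open>r\<close>, written as a second difference
  of positive parts so that the same combination of their squares, \<open>bump_int\<close>, is a
  primitive.\<close>

definition bump :: "real \<Rightarrow> real \<Rightarrow> real" where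
  "bump r s = (max 0 (s + r) - 2 * max 0 s + max 0 (s - r)) / 2"

definition bump_int :: "real \<Rightarrow> real \<Rightarrow> real" where
  "bump_int r s = ((max 0 (s + r))\<^sup>2 - 2 * (max 0 s)\<^sup>2 + (max 0 (s - r))\<^sup>2) / 4"

lemma bump_eq: "r \<ge> 0 \<Longrightarrow> bump r s = max 0 (r - \<bar>s\<bar>) / 2"
  unfolding bump_def by (auto simp: max_def abs_if field_simps)

lemma DERIV_bump_int: "(bump_int r has_real_derivative bump r s) (at s)"
  unfolding bump_int_def bump_def by (auto intro!: derivative_eq_intros)

lemma bump_int_eq_0: "r \<ge> 0 \<Longrightarrow> s \<le> - r \<Longrightarrow> bump_int r s = 0"
  by (simp add: bump_int_def)

lemma bump_int_eq_total: "r \<ge> 0 \<Longrightarrow> s \<ge> r \<Longrightarrow> bump_int r s = r\<^sup>2 / 2"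
  by (simp add: bump_int_def power2_eq_square algebra_simps)

lemma bump_int_nonneg: "r \<ge> 0 \<Longrightarrow> bump_int r s \<ge> 0"
proof -
  assume r: "r \<ge> 0"
  consider "s \<le> 0" | "0 \<le> s" "s \<le> r" | "r \<le> s" by linarith
  then show ?thesis
  proof cases
    case 1
    then show ?thesis using r by (simp add: bump_int_def)
  next
    case 2
    have "s * s \<le> r * s" using 2 r by (intro mult_right_mono)
    moreover have "r * r \<ge> 0" "r * s \<ge> 0" using 2 r by auto
    ultimately have "0 \<le> 2 * (r * s) + r * r - s * s" by linarith
    also have "\<dots> = (s + r)\<^sup>2 - 2 * s\<^sup>2" by (simp add: power2_eq_square algebra_simps)
    finally show ?thesis using 2 r by (simp add: bump_int_def)
  next
    case 3
    then show ?thesis using r by (simp add: bump_int_eq_total)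
  qed
qed

text \<open>A primitive of the 1-periodic extension of \<open>bump r\<close>: each full period adds
  the mass \<open>r\<^sup>2 / 2\<close> of one tent, and the tent at the nearest integer is
  traversed in part.\<close>

definition bump_sum :: "real \<Rightarrow> real \<Rightarrow> real" where
  "bump_sum r y = r\<^sup>2 / 2 * of_int (round y) + bump_int r (y - of_int (round y))"

text \<open>Where \<open>round y\<close> differs from \<open>N\<close>, the point lies outside both
  tents: one primitive is \<open>0\<close>, the other \<open>r\<^sup>2 / 2\<close>. This difference
  exactly offsets the jump of \<open>round\<close>, so one formula with fixed \<open>N\<close> is
  valid across half-integers and can be differentiated there.\<close>

lemma bump_sum_eq:
  assumes r: "0 \<le> r" "r \<le> 1/2" and y: "\<bar>y - of_int N\<bar> < 1 - r"
  shows "bump_sum r y = r\<^sup>2 / 2 * of_int N + bump_int r (y - of_int N)"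
proof -
  define k where "k = round y"
  have k: "\<bar>y - of_int k\<bar> \<le> 1/2"
    using int_dist_le_half[of y] by (simp add: int_dist_def k_def)
  have "\<bar>of_int (N - k) :: real\<bar> < 2" using k y r by linarith
  then consider "k = N" | "k = N + 1" | "k = N - 1" by linarith
  then show ?thesis
  proof cases
    case 2
    then have kN: "of_int k = (of_int N + 1 :: real)" by simp
    have "y - of_int k \<le> - r" "r \<le> y - of_int N" using kN k y r by linarith+
    note b = bump_int_eq_0[OF r(1) this(1)] bump_int_eq_total[OF r(1) this(2)]
    show ?thesis unfolding bump_sum_def k_def[symmetric] kN b[unfolded kN] by (simp add: field_simps)
  next
    case 3
    then have kN: "of_int k = (of_int N - 1 :: real)" by simp
    have "r \<le> y - of_int k" "y - of_int N \<le> - r" using kN k y r by linarith+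
    note b = bump_int_eq_total[OF r(1) this(1)] bump_int_eq_0[OF r(1) this(2)]
    show ?thesis unfolding bump_sum_def k_def[symmetric] kN b[unfolded kN] by (simp add: field_simps)
  qed (simp add: bump_sum_def k_def)
qed

lemma DERIV_bump_sum:
  assumes r: "0 \<le> r" "r < 1/2"
  shows "(bump_sum r has_real_derivative max 0 (r - int_dist y) / 2) (at y)"
proof -
  define N where "N = round y"
  have eq: "max 0 (r - int_dist y) / 2 = bump r (y - of_int N)"
    using r by (simp add: bump_eq int_dist_def N_def)
  have "((\<lambda>y. r\<^sup>2 / 2 * of_int N + bump_int r (y - of_int N)) has_real_derivative bump r (y - of_int N)) (at y)"
    by (auto intro!: derivative_eq_intros DERIV_chain2[OF DERIV_bump_int])
  then show ?thesis
    unfolding eq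
  proof (rule has_field_derivative_transform_within_open)
    \<comment> \<open>As \<open>r < 1/2\<close>, the radius \<open>1 - r\<close> exceeds
      \<open>1/2\<close>, so this neighbourhood of \<open>N\<close> contains \<open>y\<close> even
      at half-integers.\<close>
    show "open {y. \<bar>y - of_int N\<bar> < 1 - r}"
      by (intro open_Collect_less continuous_intros)
    show "y \<in> {y. \<bar>y - of_int N\<bar> < 1 - r}"
      using int_dist_le_half[of y] r by (simp add: int_dist_def N_def)
  qed (use bump_sum_eq[of r] r in auto)
qed

definition slope :: "real \<Rightarrow> real \<Rightarrow> real" where
  "slope r y = (1 + max 0 (r - int_dist y) / 2) / (1 + r\<^sup>2 / 2)"

text \<open>The plane \<open>- y\<close> plus a 1-periodic corrector, since
  \<open>y + bump_sum r y\<close> grows by \<open>1 + r\<^sup>2 / 2\<close> per period.\<close>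

definition profile :: "real \<Rightarrow> real \<Rightarrow> real" where
  "profile r y = - (y + bump_sum r y) / (1 + r\<^sup>2 / 2)"

lemma DERIV_profile:
  assumes "0 \<le> r" "r < 1/2"
  shows "(profile r has_real_derivative - slope r y) (at y)"
proof -
  have "((\<lambda>y. - (y + bump_sum r y) / (1 + r\<^sup>2 / 2)) has_real_derivative
      - (1 + max 0 (r - int_dist y) / 2) / (1 + r\<^sup>2 / 2)) (at y)"
    by (intro DERIV_cdivide DERIV_minus DERIV_add DERIV_ident DERIV_bump_sum[OF assms])
  then show ?thesis
    unfolding profile_def slope_def by (simp only: minus_divide_left)
qed

text \<open>With \<open>\<beta> = r\<^sup>2 / 2\<close> and \<open>s\<close> the offset from the
  nearest integer, the corrector equals \<open>(\<beta> * s - bump_int r s) / (1 + \<beta>)\<close>;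
  then \<open>s \<le> 1/2\<close> and \<open>bump_int r s \<ge> 0\<close> suffice.\<close>

lemma profile_le:
  assumes r: "0 \<le> r" "r < 1/2"
  shows "profile r y \<le> - y + r\<^sup>2 / 4"
proof -
  define \<beta> where "\<beta> = r\<^sup>2 / 2"
  define s where "s = y - of_int (round y)"
  have \<beta>: "\<beta> \<ge> 0" by (simp add: \<beta>_def)
  have "s \<le> 1/2" using int_dist_le_half[of y] unfolding int_dist_def s_def by linarith
  then have "\<beta> * s \<le> \<beta> * (1/2)" using \<beta> by (intro mult_left_mono)
  moreover have "bump_sum r y = \<beta> * (y - s) + bump_int r s"
    by (simp add: bump_sum_def s_def \<beta>_def)
  ultimately have "\<beta> * y - bump_sum r y \<le> \<beta> / 2"
    using bump_int_nonneg[OF r(1), of s] by (simp add: algebra_simps)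
  also have "\<dots> \<le> \<beta> / 2 * (1 + \<beta>)" using \<beta> by (simp add: algebra_simps)
  finally have "- (y + bump_sum r y) \<le> (- y + \<beta> / 2) * (1 + \<beta>)" by (simp add: algebra_simps)
  then have "profile r y \<le> - y + \<beta> / 2"
    using \<beta> unfolding profile_def \<beta>_def[symmetric] by (simp add: divide_le_eq add_nonneg_pos)
  then show ?thesis by (simp add: \<beta>_def)
qed

lemma profile_0_ge:
  assumes r: "0 \<le> r"
  shows "profile r 0 \<ge> - r\<^sup>2 / 4"
proof -
  have *: "bump_sum r 0 = r\<^sup>2 / 4"
    using r by (simp add: bump_sum_def bump_int_def)
  have "profile r 0 = - (r\<^sup>2 / 4 / (1 + r\<^sup>2 / 2))" unfolding profile_def * by simp
  moreover have "r\<^sup>2 / 4 / (1 + r\<^sup>2 / 2) \<le> r\<^sup>2 / 4 / 1"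
    by (intro divide_left_mono) (auto intro: add_pos_nonneg)
  ultimately show ?thesis by simp
qed

lemma continuous_on_slope [continuous_intros]:
  "continuous_on A f \<Longrightarrow> continuous_on A (\<lambda>x. slope r (f x))"
  unfolding slope_def
  by (intro continuous_intros) (use zero_le_power2[of r] in \<open>auto simp: add_nonneg_eq_0_iff\<close>)

text \<open>To first order in \<open>m\<close> the loss \<open>1 - m\<close> in the coefficient
  balances the square of \<open>1 + m / 2\<close>; the remainder
  \<open>- (3 * m\<^sup>2 + m ^ 3) / 4\<close> has the favourable sign.\<close>

lemma coeff_a_slope_le:
  assumes r: "0 \<le> r" and y: "r\<^sup>2 \<le> lattice_dist2 y"
  shows "coeff_a y * (slope r (y $ 1))\<^sup>2 \<le> 1 / (1 + r\<^sup>2 / 2)\<^sup>2"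
proof -
  define s h m where "s = int_dist (y $ 1)" and "h = int_dist (y $ 2)" and "m = max 0 (r - s)"
  have sh: "0 \<le> s" "0 \<le> h" by (simp_all add: s_def h_def)
  have "r\<^sup>2 \<le> (s + h)\<^sup>2"
    using y sh mult_nonneg_nonneg[OF sh] unfolding lattice_dist2_def s_def[symmetric] h_def[symmetric]
    unfolding power2_sum by linarith
  then have "r \<le> s + h" by (rule power2_le_imp_le) (use sh in simp)
  then have m: "0 \<le> m" "m \<le> h" using sh by (auto simp: m_def)
  have "(1 - h) * (1 + m / 2)\<^sup>2 \<le> (1 - m) * (1 + m / 2)\<^sup>2"
    using m by (intro mult_right_mono) auto
  also have "\<dots> = 1 - (3 * m\<^sup>2 + m ^ 3) / 4"
    by (simp add: power2_eq_square power3_eq_cube field_simps)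
  also have "\<dots> \<le> 1" using m by simp
  finally have "(1 - h) * (1 + m / 2)\<^sup>2 / (1 + r\<^sup>2 / 2)\<^sup>2 \<le> 1 / (1 + r\<^sup>2 / 2)\<^sup>2"
    by (intro divide_right_mono) auto
  then show ?thesis
    unfolding coeff_a_int_dist slope_def power_divide s_def[symmetric] h_def[symmetric] m_def[symmetric]
    by simp
qed

section \<open>Lower bound for the state-constraint solution\<close>

lemma C1_test_component:
  assumes "\<And>s. (f has_real_derivative f' s) (at s)" "continuous_on UNIV f'"
  shows "C1_test (\<lambda>z :: (real^'n) \<times> real. f (fst z $ i)) (\<lambda>z. f' (fst z $ i) *\<^sub>R axis i 1) (\<lambda>z. 0)"
  unfolding C1_test_def
proof (intro conjI ballI)
  fix z :: "(real^'n) \<times> real"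
  have "((\<lambda>z. fst z $ i) has_derivative (\<lambda>h. fst h $ i)) (at z)"
    by (auto intro!: derivative_eq_intros bounded_linear.has_derivative[OF bounded_linear_vec_nth])
  then have "((\<lambda>z. f (fst z $ i)) has_derivative (\<lambda>h. f' (fst z $ i) * fst h $ i)) (at z)"
    using assms(1)[of "fst z $ i"] has_derivative_compose
    unfolding has_field_derivative_def by fastforce
  then show "((\<lambda>z. f (fst z $ i)) has_derivative
      (\<lambda>(h, k). (f' (fst z $ i) *\<^sub>R axis i 1) \<bullet> h + 0 * k)) (at z)"
    by (simp add: split_beta' inner_axis' mult.commute)
  show "continuous_on (UNIV \<times> {0<..}) (\<lambda>z::(real^'n) \<times> real. f' (fst z $ i) *\<^sub>R (axis i 1 :: real^'n))"
    by (intro continuous_intros continuous_on_compose2[OF assms(2)]) auto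
qed simp

lemma C1_test_growing_square:
  "C1_test (\<lambda>z. k * (1 + snd z) * (norm (fst z))\<^sup>2) (\<lambda>z. (2 * k * (1 + snd z)) *\<^sub>R fst z)
     (\<lambda>z. k * (norm (fst z))\<^sup>2)"
  unfolding C1_test_def power2_norm_eq_inner
  by (auto intro!: continuous_intros derivative_eq_intros
      simp: split_beta fun_eq_iff algebra_simps inner_commute)

lemma norm_convex_combination_squared:
  fixes x y :: "'a::real_inner"
  assumes "0 \<le> \<theta>" "\<theta> \<le> 1"
  shows "(norm ((1 - \<theta>) *\<^sub>R x + \<theta> *\<^sub>R y))\<^sup>2 \<le> (1 - \<theta>) * (norm x)\<^sup>2 + \<theta> * (norm y)\<^sup>2"
proof -
  have "(1 - \<theta>) * (norm x)\<^sup>2 + \<theta> * (norm y)\<^sup>2 - (norm ((1 - \<theta>) *\<^sub>R x + \<theta> *\<^sub>R y))\<^sup>2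
      = (1 - \<theta>) * \<theta> * (norm (x - y))\<^sup>2"
    unfolding power2_norm_eq_inner
    by (simp add: inner_diff inner_add inner_commute algebra_simps power2_eq_square)
  moreover have "\<dots> \<ge> 0" using assms by simp
  ultimately show ?thesis by linarith
qed


text \<open>The comparison function is the rescaled profile minus \<open>lam * t\<close>, with
  \<open>lam\<close> the lowered effective Hamiltonian. The shift by
  \<open>\<epsilon> * (r\<^sup>2 / 4)\<close> puts it below the initial data. A perturbation of
  weight \<open>\<theta>\<close> confines the touching point and is removed by letting
  \<open>\<theta>\<close> tend to 0.\<close>

lemma state_constraint_solution_ge_profile:
  assumes \<epsilon>: "0 < \<epsilon>" "\<epsilon> \<le> 1" and \<eta>: "0 \<le> \<eta> \<epsilon>" "\<eta> \<epsilon> < 1"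
    and sol: "state_constraint_solution (\<lambda>x. hamiltonian (x /\<^sub>R \<epsilon>)) (scaled_domain \<eta> \<epsilon>) initial_g u"
    and x0: "x0 \<in> closure (scaled_domain \<eta> \<epsilon>)" and r: "r = \<eta> \<epsilon> / 4"
  shows "u (x0, 1) \<ge> \<epsilon> * profile r (x0 $ 1 / \<epsilon>) - \<epsilon> * (r\<^sup>2 / 4) - 1 / (2 * (1 + r\<^sup>2 / 2)\<^sup>2)"
proof -
  define S where "S = closure (scaled_domain \<eta> \<epsilon>)"
  define lam where "lam = 1 / (2 * (1 + r\<^sup>2 / 2)\<^sup>2)"
  define w where "w = \<epsilon> * profile r (x0 $ 1 / \<epsilon>) - \<epsilon> * (r\<^sup>2 / 4) - lam"
  have r': "0 \<le> r" "r < 1/2" using \<eta> r by auto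
  have cont: "continuous_on (S \<times> {0..}) u"
    and sub: "viscosity_subsolution (\<lambda>x. hamiltonian (x /\<^sub>R \<epsilon>)) (scaled_domain \<eta> \<epsilon>) u"
    and super: "viscosity_supersolution (\<lambda>x. hamiltonian (x /\<^sub>R \<epsilon>)) S u"
    and init: "\<And>x. x \<in> S \<Longrightarrow> u (x, 0) = - (x $ 1)"
    using sol unfolding state_constraint_solution_def S_def initial_g_def by auto
  have prof: "\<epsilon> * profile r (s / \<epsilon>) - \<epsilon> * (r\<^sup>2 / 4) \<le> - s" for s
  proof -
    have "\<epsilon> * profile r (s / \<epsilon>) \<le> \<epsilon> * (- (s / \<epsilon>) + r\<^sup>2 / 4)"
      using \<epsilon> profile_le[OF r'] by (intro mult_left_mono) auto
    then show ?thesis using \<epsilon> by (simp add: algebra_simps)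
  qed
  \<comment> \<open>The term with factor \<open>\<theta>\<close> is the value at
    \<open>(x0, 1)\<close> of \<open>- (1 + t) * (norm x)\<^sup>2 / 20 - 5 - t\<close>.\<close>
  have bound: "u (x0, 1) \<ge> (1 - \<theta>) * w + \<theta> * (- (norm x0)\<^sup>2 / 10 - 6)" if \<theta>: "0 < \<theta>" "\<theta> < 1" for \<theta>
  proof -
    \<comment> \<open>The coefficient \<open>\<theta> / 40\<close> is half of the
      \<open>\<theta> / 20\<close> in the test function, which therefore falls below
      \<open>u\<close> far away.\<close>
    obtain K where K: "K \<ge> 0"
      "\<And>x t. x \<in> S \<Longrightarrow> t \<in> {0..2} \<Longrightarrow> u (x, t) \<ge> - K - \<theta> / 40 * (norm x)\<^sup>2"
      using subsolution_growth[where \<eta> = \<eta>, OF \<epsilon> \<eta> sub cont[unfolded S_def], of "\<theta> / 40"] \<theta>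
      \<comment> \<open>The growth bound is stated over the closure of the scaled domain,
        abbreviated here as \<open>S\<close>.\<close>
      unfolding S_def by auto
    \<comment> \<open>The first summand of \<open>R\<close> gives
      \<open>K + R \<le> \<theta> / 40 * R\<^sup>2\<close>, needed on the sphere; the second puts
      \<open>x0\<close> inside. In \<open>M\<close>, the term \<open>10 / \<theta>\<close> is the
      maximum of \<open>n - \<theta> / 40 * n\<^sup>2\<close>, so at \<open>t = 2\<close> the
      penalty beats the growth bound for all \<open>x\<close>.\<close>
    define R where "R = 40 * (K + 1) / \<theta> + norm x0"
    define M where "M = K + 10 / \<theta>"
    have "M \<ge> 0" using K(1) \<theta> by (simp add: M_def)
    have R: "\<theta> * R / 40 \<ge> K + 1" "R \<ge> 1"
    proof -
      have "\<theta> * (40 * (K + 1) / \<theta>) \<le> \<theta> * R" using \<theta> by (intro mult_left_mono) (auto simp: R_def)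
      then show R: "\<theta> * R / 40 \<ge> K + 1" using \<theta> by simp
      have "R \<ge> 0" using K(1) \<theta> by (simp add: R_def)
      then have "\<theta> * R \<le> 1 * R" using \<theta> by (intro mult_right_mono) auto
      with R K(1) show "R \<ge> 1" by linarith
    qed
    have x0R: "norm x0 < R"
      using K(1) \<theta> by (simp add: R_def)
    \<comment> \<open>By convexity of \<open>p \<mapsto> |p|\<^sup>2\<close> the combination with \<open>- (1 + t) |x|\<^sup>2 / 20 - 5\<close>, a
      subsolution for \<open>t \<le> 2\<close> lying below the initial data, is still a subsolution; it forces the
      touching point into a ball. The term in \<open>M\<close> excludes the time \<open>t = 2\<close>.\<close>
    define F where "F s = (1 - \<theta>) * (\<epsilon> * profile r (s / \<epsilon>))" for s
    define F' where "F' s = - (1 - \<theta>) * slope r (s / \<epsilon>)" for s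
    define f where "f t = - (1 - \<theta>) * (\<epsilon> * (r\<^sup>2 / 4) + lam * t) - 5 * \<theta> - \<theta> * t - M * (max 0 (t - 1))\<^sup>2" for t
    define f' where "f' t = - (1 - \<theta>) * lam - \<theta> - M * (2 * max 0 (t - 1))" for t
    have F_deriv: "(F has_real_derivative F' s) (at s)" for s
      unfolding F_def F'_def using \<epsilon>(1)
      by (auto intro!: derivative_eq_intros DERIV_chain2[OF DERIV_profile[OF r']] simp: algebra_simps)
    have f_deriv: "(f has_real_derivative f' t) (at t)" for t
      unfolding f_def f'_def by (auto intro!: derivative_eq_intros simp: algebra_simps)
    have cF: "continuous_on A F'" "continuous_on A f" "continuous_on A f'" for A
      unfolding F'_def f_def f'_def using \<epsilon>(1) by (intro continuous_intros; simp)+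
    have cF0: "continuous_on A F" for A
      using DERIV_continuous_on F_deriv has_field_derivative_at_within by blast
    let ?\<phi> = "\<lambda>z :: (real^2) \<times> real. F (fst z $ 1) + - \<theta> / 20 * (1 + snd z) * (norm (fst z))\<^sup>2 + f (snd z)"
    have \<phi>_le: "?\<phi> (x, t) \<le> norm x - \<theta> / 20 * (norm x)\<^sup>2 - M * (max 0 (t - 1))\<^sup>2" if t: "t \<ge> 0" for x t
    proof -
      have "(1 - \<theta>) * (\<epsilon> * profile r (x $ 1 / \<epsilon>) - \<epsilon> * (r\<^sup>2 / 4)) \<le> (1 - \<theta>) * norm x"
        using prof[of "x $ 1"] component_le_norm_cart[of x 1] \<theta> by (intro mult_left_mono) auto
      also have "\<dots> \<le> norm x" using \<theta> by (intro mult_left_le_one_le) auto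
      finally have "(1 - \<theta>) * (\<epsilon> * profile r (x $ 1 / \<epsilon>) - \<epsilon> * (r\<^sup>2 / 4)) \<le> norm x" .
      moreover have "(1 - \<theta>) * (lam * t) \<ge> 0" using \<theta> t by (simp add: lam_def)
      moreover have "\<theta> / 20 * t * (norm x)\<^sup>2 \<ge> 0" "\<theta> * t \<ge> 0" using \<theta> t by auto
      ultimately show ?thesis using \<theta>
        unfolding F_def f_def fst_conv snd_conv
        by (simp add: algebra_simps add_divide_distrib diff_divide_distrib)
    qed
    have "?\<phi> (x0, 1) \<le> u (x0, 1)"
    proof (rule supersolution_ge_test[OF super C1_test_add[OF C1_test_add[OF
            C1_test_component[OF F_deriv cF(1)] C1_test_growing_square] C1_test_time[OF f_deriv cF(3)]]])
      show "compact ((S \<inter> cball 0 R) \<times> {0 .. 2 :: real})"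
        by (intro compact_Times closed_Int_compact) (auto simp: S_def)
      show "open (ball (0 :: real^2) R \<times> {0 :: real<..<2})" by (intro open_Times) auto
      show "continuous_on ((S \<inter> cball 0 R) \<times> {0..2}) u"
        by (rule continuous_on_subset[OF cont]) auto
      show "continuous_on ((S \<inter> cball 0 R) \<times> {0..2}) ?\<phi>"
        by (intro continuous_intros continuous_on_compose2[OF cF0] continuous_on_compose2[OF cF(2)]) auto
      show "(x0, 1) \<in> (S \<inter> cball 0 R) \<times> {0 .. 2 :: real}" using x0 x0R by (auto simp: S_def)
    next
      fix z assume z: "z \<in> (S \<inter> cball 0 R) \<times> {0..2} - ball (0 :: real^2) R \<times> {0 :: real<..<2}"
      obtain x t where [simp]: "z = (x, t)" by fastforce
      have x: "x \<in> S" and t: "0 \<le> t" "t \<le> 2" using z by auto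
      have u: "u (x, t) \<ge> - K - \<theta> / 40 * (norm x)\<^sup>2" using K(2) x t by auto
      consider "t = 0" | "t = 2" | "norm x = R" using z t by fastforce
      then show "?\<phi> z \<le> u z"
      proof cases
        case 1
        have "(1 - \<theta>) * (\<epsilon> * profile r (x $ 1 / \<epsilon>) - \<epsilon> * (r\<^sup>2 / 4)) \<le> (1 - \<theta>) * - (x $ 1)"
          using prof[of "x $ 1"] \<theta> by (intro mult_left_mono) auto
        moreover have "\<theta> * (- (norm x)\<^sup>2 / 20 - 5) \<le> \<theta> * - (x $ 1)"
        proof (intro mult_left_mono)
          show "- (norm x)\<^sup>2 / 20 - 5 \<le> - (x $ 1)"
            \<comment> \<open>The constant \<open>5\<close> completes the square:
              \<open>n \<le> n\<^sup>2 / 20 + 5\<close>, with equality at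
              \<open>n = 10\<close>.\<close>
            using component_le_norm_cart[of x 1] zero_le_power2[of "norm x - 10"]
            by (simp add: power2_diff)
        qed (use \<theta> in auto)
        ultimately show ?thesis
          using 1 init[OF x] by (simp add: F_def f_def algebra_simps add_divide_distrib diff_divide_distrib)
      next
        case 2
        have "0 \<le> (\<theta> * norm x - 20)\<^sup>2 / (40 * \<theta>)" using \<theta> by simp
        also have "\<dots> = \<theta> / 40 * (norm x)\<^sup>2 - norm x + 10 / \<theta>"
          using \<theta> by (simp add: power2_diff field_simps power2_eq_square)
        finally show ?thesis
          using 2 u \<phi>_le[of t x] t by (simp add: M_def)
      next
        case 3
        have "(K + 1) * R \<le> \<theta> * R / 40 * R" using R by (intro mult_right_mono) auto
        moreover have "K * 1 \<le> K * R" using R K(1) by (intro mult_left_mono)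
        ultimately have "K + R \<le> \<theta> / 40 * (norm x)\<^sup>2"
          unfolding 3 by (simp add: algebra_simps power2_eq_square)
        moreover have "M * (max 0 (t - 1))\<^sup>2 \<ge> 0" using \<open>M \<ge> 0\<close> by simp
        ultimately show ?thesis
          using 3 u \<phi>_le[of t x] t by simp
      qed
    next
      fix x t assume xt: "(x, t) \<in> (S \<inter> cball 0 R) \<times> {0..2} \<inter> ball (0 :: real^2) R \<times> {0 :: real<..<2}"
      define q where "q = slope r (x $ 1 / \<epsilon>)"
      define p where "p = (1 - \<theta>) *\<^sub>R (- q *\<^sub>R axis 1 1) + \<theta> *\<^sub>R ((- ((1 + t) / 10)) *\<^sub>R x)"
      define A where "A = coeff_a (x /\<^sub>R \<epsilon>)"
      have A: "0 \<le> A" "A \<le> 1" using coeff_a_bounds[of "x /\<^sub>R \<epsilon>"] by (auto simp: A_def)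
      \<comment> \<open>Touching points on the rim of a hole are included: the weak inequality
        survives passage to the closure.\<close>
      have "r\<^sup>2 \<le> lattice_dist2 (x /\<^sub>R \<epsilon>)"
        using closure_scaled_domain_subset[of \<epsilon> \<eta>] \<epsilon> \<eta> xt unfolding S_def r by auto
      from coeff_a_slope_le[OF r'(1) this]
      have "A * (slope r ((x /\<^sub>R \<epsilon>) $ 1))\<^sup>2 \<le> 2 * lam"
        by (simp add: A_def lam_def)
      moreover have "(x /\<^sub>R \<epsilon>) $ 1 = x $ 1 / \<epsilon>" by (simp add: divide_inverse)
      ultimately have Aq: "A * q\<^sup>2 \<le> 2 * lam" by (simp only: q_def)
      have "(norm p)\<^sup>2 \<le> (1 - \<theta>) * (norm (- q *\<^sub>R (axis 1 1 :: real^2)))\<^sup>2 + \<theta> * (norm ((- ((1 + t) / 10)) *\<^sub>R x))\<^sup>2"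
        unfolding p_def using \<theta> by (intro norm_convex_combination_squared) auto
      also have "\<dots> = (1 - \<theta>) * q\<^sup>2 + \<theta> * ((1 + t)\<^sup>2 / 100 * (norm x)\<^sup>2)"
        by (simp add: power_mult_distrib power_divide)
      finally have "A * (norm p)\<^sup>2 \<le> A * ((1 - \<theta>) * q\<^sup>2 + \<theta> * ((1 + t)\<^sup>2 / 100 * (norm x)\<^sup>2))"
        using A by (intro mult_left_mono)
      also have "\<dots> = (1 - \<theta>) * (A * q\<^sup>2) + \<theta> * (A * (1 + t)\<^sup>2) / 100 * (norm x)\<^sup>2"
        by (simp add: algebra_simps)
      also have "\<dots> \<le> (1 - \<theta>) * (2 * lam) + \<theta> * (1 * 3\<^sup>2) / 100 * (norm x)\<^sup>2"
      proof (rule add_mono)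
        show "(1 - \<theta>) * (A * q\<^sup>2) \<le> (1 - \<theta>) * (2 * lam)"
          using Aq \<theta> by (intro mult_left_mono) auto
        have "A * (1 + t)\<^sup>2 \<le> 1 * 3\<^sup>2"
          using A xt by (intro mult_mono power_mono) auto
        then show "\<theta> * (A * (1 + t)\<^sup>2) / 100 * (norm x)\<^sup>2 \<le> \<theta> * (1 * 3\<^sup>2) / 100 * (norm x)\<^sup>2"
          using \<theta> by (intro mult_right_mono divide_right_mono mult_left_mono) auto
      qed
      \<comment> \<open>The factor \<open>9/200\<close>, from
        \<open>(1 + t)\<^sup>2 \<le> 9\<close>, is below the \<open>1/20\<close> supplied by the
        time derivative of the growing square. The separate \<open>- \<theta>\<close> in
        \<open>f'\<close> makes the inequality strict, also at \<open>x = 0\<close>.\<close>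
      finally have "A * (norm p)\<^sup>2 / 2 \<le> (1 - \<theta>) * lam + \<theta> * (norm x)\<^sup>2 * (9/200)"
        by (simp add: algebra_simps)
      moreover have "f' t \<le> - (1 - \<theta>) * lam - \<theta>" using \<open>M \<ge> 0\<close> by (simp add: f'_def)
      moreover have "\<theta> * (norm x)\<^sup>2 \<ge> 0" using \<theta> by simp
      ultimately have "- \<theta> / 20 * (norm x)\<^sup>2 + f' t + A * (norm p)\<^sup>2 / 2 < 0"
        using \<theta>(1) by argo
      moreover have "F' (x $ 1) *\<^sub>R axis 1 1 + (2 * (- \<theta> / 20) * (1 + t)) *\<^sub>R x = p"
        unfolding p_def F'_def q_def by (simp add: algebra_simps)
      ultimately show "0 + - \<theta> / 20 * (norm (fst (x, t)))\<^sup>2 + f' (snd (x, t)) +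
          hamiltonian (x /\<^sub>R \<epsilon>) (F' (fst (x, t) $ 1) *\<^sub>R axis 1 1 +
            (2 * (- \<theta> / 20) * (1 + snd (x, t))) *\<^sub>R fst (x, t) + 0) < 0"
        by (simp add: hamiltonian_def A_def)
    qed auto
    then show ?thesis by (simp add: F_def f_def w_def algebra_simps add_divide_distrib diff_divide_distrib)
  qed
  have "w \<le> u (x0, 1)"
  proof (rule field_le_epsilon)
    fix e :: real assume "e > 0"
    define c where "c = \<bar>w\<bar> + (norm x0)\<^sup>2 / 10 + 6"
    have "c > 0" by (simp add: c_def add_nonneg_pos)
    define \<theta> where "\<theta> = min (1/2) (e / c)"
    have \<theta>: "0 < \<theta>" "\<theta> < 1" using \<open>e > 0\<close> \<open>c > 0\<close> by (auto simp: \<theta>_def)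
    have "\<theta> * c \<le> e"
      using \<open>c > 0\<close> by (simp add: \<theta>_def min_def field_simps)
    moreover have "\<theta> * (w + (norm x0)\<^sup>2 / 10 + 6) \<le> \<theta> * c"
      using \<theta> by (intro mult_left_mono) (auto simp: c_def)
    ultimately show "w \<le> u (x0, 1) + e"
      using bound[OF \<theta>] by (simp add: algebra_simps)
  qed
  then show ?thesis by (simp add: w_def lam_def)
qed

section \<open>Upper bound for the free solution\<close>

text \<open>The bound \<open>\<alpha>\<close> is known only on the segment, while propagation needs
  a bound on an open set. The set where the coefficient exceeds \<open>k * \<alpha>\<close> is such
  a neighbourhood for each \<open>k < 1\<close>; then \<open>k\<close> tends to 1.\<close>

lemma cauchy_solution_along_segment:
  assumes sol: "cauchy_solution (\<lambda>x. hamiltonian (x /\<^sub>R \<epsilon>)) g u"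
    and \<alpha>: "\<alpha> > 0" "\<And>z. z \<in> closed_segment y x \<Longrightarrow> coeff_a (z /\<^sub>R \<epsilon>) \<ge> \<alpha>"
    and s: "0 \<le> s" "s < s'"
  shows "u (x, s') \<le> u (y, s) + (norm (x - y))\<^sup>2 / (2 * \<alpha> * (s' - s))"
proof -
  have "k * (u (x, s') - u (y, s)) \<le> (norm (x - y))\<^sup>2 / (2 * \<alpha> * (s' - s))" if k: "0 < k" "k < 1" for k
  proof -
    have "u (x, s') \<le> u (y, s) + (norm (x - y))\<^sup>2 / (2 * (k * \<alpha>) * (s' - s))"
    proof (rule subsolution_along_segment)
      show "viscosity_subsolution (\<lambda>x. hamiltonian (x /\<^sub>R \<epsilon>)) UNIV u" "continuous_on (UNIV \<times> {0..}) u"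
        using sol by (auto simp: cauchy_solution_def)
      show "open {z. k * \<alpha> < coeff_a (z /\<^sub>R \<epsilon>)}"
        unfolding coeff_a_int_dist by (intro open_Collect_less continuous_intros)
      show "k * \<alpha> * (norm p)\<^sup>2 / 2 \<le> hamiltonian (z /\<^sub>R \<epsilon>) p" if "z \<in> {z. k * \<alpha> < coeff_a (z /\<^sub>R \<epsilon>)}" for z p
        using that unfolding hamiltonian_def by (intro divide_right_mono mult_right_mono) auto
      have "k * \<alpha> < \<alpha>" using k \<alpha>(1) by simp
      then show "closed_segment y x \<subseteq> {z. k * \<alpha> < coeff_a (z /\<^sub>R \<epsilon>)}"
        using \<alpha>(2) by fastforce
    qed (use k \<alpha> s in auto)
    then have "k * (u (x, s') - u (y, s)) \<le> k * ((norm (x - y))\<^sup>2 / (2 * (k * \<alpha>) * (s' - s)))"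
      using k by (intro mult_left_mono) auto
    also have "\<dots> = (norm (x - y))\<^sup>2 / (2 * \<alpha> * (s' - s))"
      using k by simp
    finally show ?thesis .
  qed
  then have "u (x, s') - u (y, s) \<le> (norm (x - y))\<^sup>2 / (2 * \<alpha> * (s' - s))"
    by (rule field_le_mult_one_interval)
  then show ?thesis by simp
qed

text \<open>The path runs at unit speed along \<open>x\<^sub>2 = 0\<close> from \<open>q\<close> to
  \<open>p\<close> and uses the last time \<open>\<epsilon> / 4\<close> to reach height
  \<open>\<epsilon> * r\<close>. Its horizontal speed stays 1 throughout, so only the vertical
  motion and the coefficient drop to \<open>1 - r\<close> cost extra.\<close>

lemma cauchy_solution_le:
  assumes \<epsilon>: "0 < \<epsilon>" "\<epsilon> < 1" and r: "0 \<le> r" "r < 1/2"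
    and sol: "cauchy_solution (\<lambda>x. hamiltonian (x /\<^sub>R \<epsilon>)) initial_g u"
  shows "u ((\<epsilon> * r) *\<^sub>R axis 2 1, 1) \<le> - 1/2 + \<epsilon> * ((r / 8 + 2 * r\<^sup>2) / (1 - r))"
proof -
  define x :: "real^2" where "x = vector [0, \<epsilon> * r]"
  define p :: "real^2" where "p = vector [\<epsilon> / 4, 0]"
  define q :: "real^2" where "q = vector [1, 0]"
  have x: "(\<epsilon> * r) *\<^sub>R axis 2 1 = x"
    by (simp add: x_def vec_eq_iff forall_2 axis_def)
  have seg: "u (p, 1 - \<epsilon> / 4) \<le> u (q, 0) + (norm (p - q))\<^sup>2 / (2 * 1 * ((1 - \<epsilon> / 4) - 0))"
  proof (rule cauchy_solution_along_segment[OF sol])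
    fix z assume "z \<in> closed_segment q p"
    then have "z $ 2 = 0" by (auto simp: in_segment p_def q_def)
    then show "coeff_a (z /\<^sub>R \<epsilon>) \<ge> 1"
      by (simp add: coeff_a_int_dist int_dist_def)
  qed (use \<epsilon> in auto)
  have norm: "(norm (p - q))\<^sup>2 = (1 - \<epsilon> / 4)\<^sup>2"
    unfolding norm_vec2_squared by (simp add: p_def q_def power2_commute)
  have init: "u (q, 0) = -1"
    using sol by (simp add: cauchy_solution_def initial_g_def q_def)
  have "c\<^sup>2 / (2 * 1 * (c - 0)) = c / 2" if "c > 0" for c :: real
    using that by (simp add: power2_eq_square)
  from this[of "1 - \<epsilon> / 4"]
  have cost: "(1 - \<epsilon> / 4)\<^sup>2 / (2 * 1 * ((1 - \<epsilon> / 4) - 0)) = 1 / 2 - \<epsilon> / 8"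
    using \<epsilon> by (simp add: diff_divide_distrib)
  note 1 = seg[unfolded norm init cost]
  have "u (x, 1) \<le> u (p, 1 - \<epsilon> / 4) + (norm (x - p))\<^sup>2 / (2 * (1 - r) * (1 - (1 - \<epsilon> / 4)))"
  proof (rule cauchy_solution_along_segment[OF sol])
    fix z assume "z \<in> closed_segment p x"
    then obtain l where l: "0 \<le> l" "l \<le> 1" "z = (1 - l) *\<^sub>R p + l *\<^sub>R x"
      by (auto simp: in_segment)
    then have "(z /\<^sub>R \<epsilon>) $ 2 = l * r" using \<epsilon> by (simp add: p_def x_def)
    moreover have "int_dist (l * r) \<le> l * r" using int_dist_le[of "l * r" 0] l r by simp
    moreover have "l * r \<le> r" using l r by (simp add: mult_left_le_one_le)
    ultimately show "coeff_a (z /\<^sub>R \<epsilon>) \<ge> 1 - r"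
      by (simp add: coeff_a_int_dist)
  qed (use \<epsilon> r in auto)
  also have "(norm (x - p))\<^sup>2 = \<epsilon>\<^sup>2 * (1 / 16 + r\<^sup>2)"
    unfolding norm_vec2_squared by (simp add: p_def x_def algebra_simps power2_eq_square)
  also have "\<epsilon>\<^sup>2 * (1 / 16 + r\<^sup>2) / (2 * (1 - r) * (1 - (1 - \<epsilon> / 4))) = \<epsilon> * ((r / 8 + 2 * r\<^sup>2) / (1 - r)) + \<epsilon> / 8"
    using \<epsilon> r by (simp add: field_simps power2_eq_square)
  finally show ?thesis using 1 unfolding x by linarith
qed

section \<open>The evaluation point and the choice of constants\<close>

lemma top_of_hole_in_closure:
  assumes "0 < \<epsilon>" "0 \<le> \<eta> \<epsilon>" "\<eta> \<epsilon> < 1"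
  shows "(\<epsilon> * \<eta> \<epsilon> / 4) *\<^sub>R axis 2 1 \<in> closure (scaled_domain \<eta> \<epsilon>)"
  unfolding closure_approachable
proof (intro allI impI)
  fix e :: real assume "e > 0"
  \<comment> \<open>The cap \<open>1/4\<close> keeps \<open>\<eta> \<epsilon> / 4 + d\<close> below
    \<open>1/2\<close>, where \<open>int_dist\<close> returns the height itself.\<close>
  define d where "d = min (1/4) (e / (2 * \<epsilon>))"
  have d: "0 < d" "d \<le> 1/4" "\<epsilon> * d < e"
    using \<open>e > 0\<close> assms(1) by (auto simp: d_def min_def field_simps)
  define y :: "real^2" where "y = (\<epsilon> * (\<eta> \<epsilon> / 4 + d)) *\<^sub>R axis 2 1"
  have "int_dist (\<eta> \<epsilon> / 4 + d) = \<eta> \<epsilon> / 4 + d"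
    using int_dist_add[of "\<eta> \<epsilon> / 4 + d" 0] assms d by simp
  moreover have "(\<eta> \<epsilon> / 4)\<^sup>2 < (\<eta> \<epsilon> / 4 + d)\<^sup>2"
    using assms d by (intro power_strict_mono) auto
  moreover have y: "y /\<^sub>R \<epsilon> = (\<eta> \<epsilon> / 4 + d) *\<^sub>R axis 2 1"
    using assms(1) by (simp add: y_def)
  ultimately have "lattice_dist2 (y /\<^sub>R \<epsilon>) > (\<eta> \<epsilon> / 4)\<^sup>2"
    unfolding y by (simp add: lattice_dist2_def axis_def int_dist_def[of 0])
  then have "y \<in> scaled_domain \<eta> \<epsilon>"
    using assms(1,2) by (simp add: scaled_domain_eq[of \<epsilon> \<eta>])
  moreover have "y - (\<epsilon> * \<eta> \<epsilon> / 4) *\<^sub>R axis 2 1 = (\<epsilon> * d) *\<^sub>R axis 2 1"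
    by (simp add: y_def algebra_simps)
  then have "dist y ((\<epsilon> * \<eta> \<epsilon> / 4) *\<^sub>R axis 2 1) < e"
    using d assms(1) by (simp add: dist_norm)
  ultimately show "\<exists>y\<in>scaled_domain \<eta> \<epsilon>. dist y ((\<epsilon> * \<eta> \<epsilon> / 4) *\<^sub>R axis 2 1) < e" by blast
qed

theorem lemma5p1:
  fixes \<eta> :: "real \<Rightarrow> real"
  assumes "\<And>\<epsilon>. \<epsilon> \<in> {0..<1/3} \<Longrightarrow> \<eta> \<epsilon> \<in> {0..<1/3}"
    and "(\<eta> \<longlongrightarrow> 0) (at 0 within {0..<1/3})"
  shows "\<exists>C>0. \<forall>\<epsilon>\<in>{0<..<1/3}. \<forall>u u_free :: (real^2) \<times> real \<Rightarrow> real.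
    state_constraint_solution (\<lambda>x. hamiltonian (x /\<^sub>R \<epsilon>)) (scaled_domain \<eta> \<epsilon>) initial_g u \<longrightarrow>
    cauchy_solution (\<lambda>x. hamiltonian (x /\<^sub>R \<epsilon>)) initial_g u_free \<longrightarrow>
    u ((\<epsilon> * \<eta> \<epsilon> / 4) *\<^sub>R axis 2 1, 1)
      \<ge> u_free ((\<epsilon> * \<eta> \<epsilon> / 4) *\<^sub>R axis 2 1, 1) - C * \<epsilon> * \<eta> \<epsilon> - C * \<epsilon> + C * (\<eta> \<epsilon>)\<^sup>2"
\<comment> \<open>\<open>C\<close> multiplies losses and gain alike, so it cannot simply be taken
  large. With \<open>\<beta> = (\<eta> \<epsilon>)\<^sup>2 / 32\<close> the gain
  \<open>24/25 * \<beta>\<close> is exactly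
  \<open>3/100 * (\<eta> \<epsilon>)\<^sup>2\<close>.\<close>
proof (intro exI[of _ "3/100"] conjI ballI allI impI)
  fix \<epsilon> :: real and u u_free :: "(real^2) \<times> real \<Rightarrow> real"
  assume \<epsilon>: "\<epsilon> \<in> {0<..<1/3}"
    and u: "state_constraint_solution (\<lambda>x. hamiltonian (x /\<^sub>R \<epsilon>)) (scaled_domain \<eta> \<epsilon>) initial_g u"
    and u_free: "cauchy_solution (\<lambda>x. hamiltonian (x /\<^sub>R \<epsilon>)) initial_g u_free"
  define r where "r = \<eta> \<epsilon> / 4"
  define x0 :: "real^2" where "x0 = (\<epsilon> * \<eta> \<epsilon> / 4) *\<^sub>R axis 2 1"
  have \<eta>: "0 \<le> \<eta> \<epsilon>" "\<eta> \<epsilon> < 1/3" using assms(1)[of \<epsilon>] \<epsilon> by auto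
  then have r: "0 \<le> r" "r \<le> 1/12" by (auto simp: r_def)
  define \<beta> where "\<beta> = r\<^sup>2 / 2"
  have rr: "r * r \<le> 1/12 * r" using r by (intro mult_right_mono)
  have \<beta>: "0 \<le> \<beta>" "\<beta> \<le> 1/288" using rr r by (auto simp: \<beta>_def power2_eq_square)
  have "u (x0, 1) \<ge> \<epsilon> * profile r (x0 $ 1 / \<epsilon>) - \<epsilon> * (r\<^sup>2 / 4) - 1 / (2 * (1 + r\<^sup>2 / 2)\<^sup>2)"
    unfolding x0_def using \<epsilon> \<eta> u
    by (intro state_constraint_solution_ge_profile[where \<eta> = \<eta>] top_of_hole_in_closure) (auto simp: r_def)
  moreover have "profile r (x0 $ 1 / \<epsilon>) \<ge> - \<beta> / 2"
    using profile_0_ge[OF r(1)] by (simp add: x0_def axis_def \<beta>_def)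
  then have "\<epsilon> * profile r (x0 $ 1 / \<epsilon>) \<ge> \<epsilon> * (- \<beta> / 2)"
    using \<epsilon> by (intro mult_left_mono) auto
  \<comment> \<open>The expansion starts with \<open>1/2 - \<beta>\<close>; the factor
    \<open>24/25\<close> absorbs the higher-order terms because
    \<open>\<beta> \<le> 1/288\<close>.\<close>
  moreover have "1 / (2 * (1 + \<beta>)\<^sup>2) \<le> 1/2 - 24/25 * \<beta>"
  proof -
    have "\<beta> * \<beta> \<le> 1/288 * \<beta>" "\<beta> * (\<beta> * \<beta>) \<le> 1/288 * (\<beta> * \<beta>)"
      using \<beta> by (intro mult_right_mono; simp)+
    then have "1 \<le> (1/2 - 24/25 * \<beta>) * (2 * (1 + \<beta>)\<^sup>2)"
      using \<beta> by (simp add: power2_eq_square algebra_simps)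
    then show ?thesis using \<beta> by (simp add: divide_le_eq add_nonneg_eq_0_iff)
  qed
  ultimately have lower: "u (x0, 1) \<ge> - 1/2 + 24/25 * \<beta> - \<epsilon> * \<beta>"
    unfolding \<beta>_def by (simp add: algebra_simps)
  define e where "e = (r / 8 + 2 * r\<^sup>2) / (1 - r)"
  have "u_free ((\<epsilon> * r) *\<^sub>R axis 2 1, 1) \<le> - 1/2 + \<epsilon> * e"
    unfolding e_def using \<epsilon> r u_free by (intro cauchy_solution_le) auto
  then have "u_free (x0, 1) \<le> - 1/2 + \<epsilon> * e"
    by (simp add: x0_def r_def)
  \<comment> \<open>The \<open>- \<beta>\<close> makes room for the loss
    \<open>\<epsilon> * \<beta>\<close> in \<open>lower\<close>, half of it from the profile at 0
    and half from the shift below the initial data.\<close>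
  moreover have "e \<le> 3/100 * (1 + \<eta> \<epsilon>) - \<beta>"
  proof -
    have "e \<le> (r / 8 + 2 * r\<^sup>2) / (11/12)"
      unfolding e_def using r by (intro divide_left_mono) auto
    also have "\<dots> = 12/11 * (r / 8) + 24/11 * (r * r)" by (simp add: power2_eq_square)
    also have "\<dots> \<le> 3/100 * (1 + 4 * r) - 1/2 * (r * r)" using r rr by (simp add: field_simps)
    also have "\<dots> = 3/100 * (1 + \<eta> \<epsilon>) - \<beta>" by (simp add: \<beta>_def r_def power2_eq_square)
    finally show ?thesis .
  qed
  then have "\<epsilon> * e \<le> \<epsilon> * (3/100 * (1 + \<eta> \<epsilon>) - \<beta>)"
    using \<epsilon> by (intro mult_left_mono) auto
  moreover have "24/25 * \<beta> = 3/100 * (\<eta> \<epsilon>)\<^sup>2"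
    by (simp add: \<beta>_def r_def power2_eq_square)
  ultimately show "u ((\<epsilon> * \<eta> \<epsilon> / 4) *\<^sub>R axis 2 1, 1)
      \<ge> u_free ((\<epsilon> * \<eta> \<epsilon> / 4) *\<^sub>R axis 2 1, 1) - 3/100 * \<epsilon> * \<eta> \<epsilon> - 3/100 * \<epsilon> + 3/100 * (\<eta> \<epsilon>)\<^sup>2"
    using lower unfolding x0_def[symmetric]
    by (simp add: algebra_simps add_divide_distrib diff_divide_distrib)
qed simp

end
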